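(* Let $p$ be a prime, let $G$ be a cyclic group of order $p^n$ with $n\ge 1$, and let $H$ be the unique subgroup of $G$ of order $p$. Let $R$ be a commutative ring with unit equipped with a ring homomorphism $\mathbb{Z}[\zeta_{p^n}]\to R$, and let $M$ be a finite $R[G]$-module. Assume that $\widehat{H}^0_{\chi}(H,M)=0$ for all $\chi\in\widehat{H}$. Then $\widehat{H}^0_{\psi}(G,M)=0$ for all $\psi\in\widehat{G}$, and $$[M]=\prod_{\psi\in\widehat{G}}[M^{\psi}]=\prod_{\psi\in\widehat{G}}[\varepsilon_\psi M].$$
   Context: $[X]$ is the order of a finite set $X$; $\zeta_{p^n}$ is a primitive complex $p^n$-th root of unity. For a subgroup $\Gamma\le G$, $\widehat\Gamma$ is the set of homomorphisms $\Gamma\to\mu_{p^n}\subset\mathbb{Z}[\zeta_{p^n}]^\times$, regarded as $R$-valued via the fixed homomorphism; products over $\widehat\Gamma$ are indexed by these $|\Gamma|$ characters. For $\chi\in\widehat\Gamma$ and an $R[\Gamma]$-module $N$: $N^\chi=\{m\in N:\sigma m=\chi(\sigma)m\ \forall\sigma\in\Gamma\}$, $\varepsilon_\chi=\sum_{\sigma\in\Gamma}\chi(\sigma)^{-1}\sigma\in R[\Gamma]$, $\widehat H^0_\chi(\Gamma,N)=N^\chi/\varepsilon_\chi N$. *)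

theory Defs
  imports Complex_Main "HOL-Computational_Algebra.Primes" "HOL-Algebra.Algebra" "HOL-Algebra.Algebraic_Closure_Type"
begin

definition primitive_root_of_unity :: "nat \<Rightarrow> complex \<Rightarrow> bool" where
  "primitive_root_of_unity m \<zeta> \<longleftrightarrow> m > 0 \<and> \<zeta> ^ m = 1 \<and> (\<forall>k. 0 < k \<and> k < m \<longrightarrow> \<zeta> ^ k \<noteq> 1)"

text \<open>The ring \<open>\<int>[\<zeta>]\<close>, as a subring of the complex numbers.\<close>

definition cyclotomic_integers :: "complex \<Rightarrow> complex ring" where
  "cyclotomic_integers \<zeta> =
     ring_of_type_algebra\<lparr>carrier := generate_ring ring_of_type_algebra {\<zeta>}\<rparr>"

definition root_group :: "nat \<Rightarrow> complex monoid" where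
  "root_group m = \<lparr>carrier = {z. z ^ m = 1}, monoid.mult = (*), one = 1\<rparr>"

text \<open>Characters are complex-valued and extensional, so that over a group \<open>\<Gamma>\<close> of exponent dividing
  \<open>m\<close> there are exactly as many of them as the dual group has elements. In particular two distinct
  characters count separately even if their \<open>R\<close>-valued images coincide.\<close>

definition characters :: "nat \<Rightarrow> ('g, 'b) monoid_scheme \<Rightarrow> ('g \<Rightarrow> complex) set" where
  "characters m \<Gamma> = hom \<Gamma> (root_group m) \<inter> extensional (carrier \<Gamma>)"

text \<open>The group ring \<open>R[G]\<close> of a finite group \<open>G\<close>: the formal sum \<open>\<Sum>\<sigma>. a\<^sub>\<sigma> \<sigma>\<close> is represented by its
  coefficient function \<open>\<sigma> \<mapsto> a\<^sub>\<sigma>\<close>. For infinite \<open>G\<close> a finite-support condition would be needed.\<close>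

definition group_ring :: "('r, 'a) ring_scheme \<Rightarrow> ('g, 'b) monoid_scheme \<Rightarrow> ('g \<Rightarrow> 'r) ring" where
  "group_ring R G =
     \<lparr>carrier = carrier G \<rightarrow>\<^sub>E carrier R,
      monoid.mult = (\<lambda>a b. \<lambda>\<sigma>\<in>carrier G.
                \<Oplus>\<^bsub>R\<^esub>\<tau>\<in>carrier G. a \<tau> \<otimes>\<^bsub>R\<^esub> b (inv\<^bsub>G\<^esub> \<tau> \<otimes>\<^bsub>G\<^esub> \<sigma>)),
      monoid.one = (\<lambda>\<sigma>\<in>carrier G. if \<sigma> = \<one>\<^bsub>G\<^esub> then \<one>\<^bsub>R\<^esub> else \<zero>\<^bsub>R\<^esub>),
      ring.zero = (\<lambda>\<sigma>\<in>carrier G. \<zero>\<^bsub>R\<^esub>),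
      ring.add = (\<lambda>a b. \<lambda>\<sigma>\<in>carrier G. a \<sigma> \<oplus>\<^bsub>R\<^esub> b \<sigma>)\<rparr>"

text \<open>The element \<open>r \<sigma>\<close> of \<open>R[G]\<close>.\<close>

definition gr_monom ::
    "('r, 'a) ring_scheme \<Rightarrow> ('g, 'b) monoid_scheme \<Rightarrow> 'r \<Rightarrow> 'g \<Rightarrow> 'g \<Rightarrow> 'r" where
  "gr_monom R G r \<sigma> = (\<lambda>\<tau>\<in>carrier G. if \<tau> = \<sigma> then r else \<zero>\<^bsub>R\<^esub>)"

text \<open>An \<open>R[G]\<close>-module viewed as an \<open>R[H]\<close>-module, along the inclusion \<open>R[H] \<subseteq> R[G]\<close> that extends
  coefficient functions by zero.\<close>

definition gr_incl ::
    "('r, 'a) ring_scheme \<Rightarrow> ('g, 'b) monoid_scheme \<Rightarrow> 'g set \<Rightarrow> ('g \<Rightarrow> 'r) \<Rightarrow> 'g \<Rightarrow> 'r" where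
  "gr_incl R G H a = (\<lambda>\<sigma>\<in>carrier G. if \<sigma> \<in> H then a \<sigma> else \<zero>\<^bsub>R\<^esub>)"

definition restrict_module ::
    "('r, 'a) ring_scheme \<Rightarrow> ('g, 'b) monoid_scheme \<Rightarrow> 'g set \<Rightarrow>
     ('g \<Rightarrow> 'r, 'm, 'c) module_scheme \<Rightarrow> ('g \<Rightarrow> 'r, 'm, 'c) module_scheme" where
  "restrict_module R G H M = M\<lparr>smult := (\<lambda>a m. gr_incl R G H a \<odot>\<^bsub>M\<^esub> m)\<rparr>"

text \<open>In the following, \<open>h\<close> is the structure map from the cyclotomic integers to \<open>R\<close>, through which
  a character \<open>\<chi>\<close> of \<open>\<Gamma>\<close> takes values in \<open>R\<close>, and \<open>N\<close> is an \<open>R[\<Gamma>]\<close>-module.\<close>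

definition eigenspace ::
    "('r, 'a) ring_scheme \<Rightarrow> ('g, 'b) monoid_scheme \<Rightarrow> (complex \<Rightarrow> 'r) \<Rightarrow> ('g \<Rightarrow> complex) \<Rightarrow>
     ('g \<Rightarrow> 'r, 'm, 'c) module_scheme \<Rightarrow> 'm set" where
  "eigenspace R \<Gamma> h \<chi> N =
     {m \<in> carrier N. \<forall>\<sigma>\<in>carrier \<Gamma>.
        gr_monom R \<Gamma> \<one>\<^bsub>R\<^esub> \<sigma> \<odot>\<^bsub>N\<^esub> m = gr_monom R \<Gamma> (h (\<chi> \<sigma>)) \<one>\<^bsub>\<Gamma>\<^esub> \<odot>\<^bsub>N\<^esub> m}"

text \<open>The element \<open>\<epsilon>\<^sub>\<chi> = \<Sum>\<sigma>. \<chi>(\<sigma>)\<^sup>-\<^sup>1 \<sigma>\<close> of \<open>R[\<Gamma>]\<close>.\<close>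

definition char_elem ::
    "('r, 'a) ring_scheme \<Rightarrow> ('g, 'b) monoid_scheme \<Rightarrow> (complex \<Rightarrow> 'r) \<Rightarrow> ('g \<Rightarrow> complex) \<Rightarrow>
     'g \<Rightarrow> 'r" where
  "char_elem R \<Gamma> h \<chi> =
     (\<Oplus>\<^bsub>group_ring R \<Gamma>\<^esub>\<sigma>\<in>carrier \<Gamma>. gr_monom R \<Gamma> (h (inverse (\<chi> \<sigma>))) \<sigma>)"

definition char_image ::
    "('r, 'a) ring_scheme \<Rightarrow> ('g, 'b) monoid_scheme \<Rightarrow> (complex \<Rightarrow> 'r) \<Rightarrow> ('g \<Rightarrow> complex) \<Rightarrow>
     ('g \<Rightarrow> 'r, 'm, 'c) module_scheme \<Rightarrow> 'm set" where
  "char_image R \<Gamma> h \<chi> N = (\<lambda>m. char_elem R \<Gamma> h \<chi> \<odot>\<^bsub>N\<^esub> m) ` carrier N"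

text \<open>The quotient of the eigenspace by the image of \<open>\<epsilon>\<^sub>\<chi>\<close>, as an abelian group (the \<open>R[\<Gamma>]\<close>-action
  on it is forgotten).\<close>

definition char_H0 ::
    "('r, 'a) ring_scheme \<Rightarrow> ('g, 'b) monoid_scheme \<Rightarrow> (complex \<Rightarrow> 'r) \<Rightarrow> ('g \<Rightarrow> complex) \<Rightarrow>
     ('g \<Rightarrow> 'r, 'm, 'c) module_scheme \<Rightarrow> 'm set monoid" where
  "char_H0 R \<Gamma> h \<chi> N =
     N\<lparr>carrier := eigenspace R \<Gamma> h \<chi> N\<rparr> A_Mod char_image R \<Gamma> h \<chi> N"

lemma a_inv_type_algebra: "\<ominus>\<^bsub>ring_of_type_algebra\<^esub> x = - (x :: complex)"
proof -
  interpret C: cring "ring_of_type_algebra :: complex ring" by (rule cring_from_type_algebra)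
  show ?thesis
    by (rule C.minus_equality) (auto simp: ring_of_type_algebra_def)
qed

lemma cring_cyclotomic_integers: "cring (cyclotomic_integers \<zeta>)"
proof -
  interpret C: cring "ring_of_type_algebra :: complex ring" by (rule cring_from_type_algebra)
  have "subcring (generate_ring ring_of_type_algebra {\<zeta>}) (ring_of_type_algebra :: complex ring)"
    by (intro C.subcringI' C.generate_ring_is_subring) (auto simp: ring_of_type_algebra_def)
  then show ?thesis
    unfolding cyclotomic_integers_def by (rule C.subcring_iff[THEN iffD1, rotated]) (auto simp: ring_of_type_algebra_def)
qed

text \<open>For a primitive \<open>m\<close>-th root of unity \<open>\<zeta>\<close>, the group \<open>\<mu>\<^sub>m\<close> is contained in \<open>\<int>[\<zeta>]\<^sup>\<times>\<close>.\<close>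

lemma root_group_subset_Units:
  assumes "primitive_root_of_unity m \<zeta>"
  shows "carrier (root_group m) \<subseteq> Units (cyclotomic_integers \<zeta>)"
proof
  let ?S = "generate_ring ring_of_type_algebra {\<zeta>}"
  have m: "m > 0" and \<zeta>1: "\<zeta> ^ m = 1" and prim: "\<And>k. 0 < k \<Longrightarrow> k < m \<Longrightarrow> \<zeta> ^ k \<noteq> 1"
    using assms by (auto simp: primitive_root_of_unity_def)
  have \<zeta>0: "\<zeta> \<noteq> 0" using \<zeta>1 m by (auto simp: zero_power)
  have pow: "\<zeta> ^ k \<in> ?S" for k
  proof (induction k)
    case 0
    then show ?case using generate_ring.one[of ring_of_type_algebra "{\<zeta>}"]
      by (simp add: ring_of_type_algebra_def)
  next
    case (Suc k)
    then show ?case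
      using generate_ring.eng_mult[OF generate_ring.incl[of \<zeta> "{\<zeta>}"] Suc]
      by (simp add: ring_of_type_algebra_def)
  qed
  have inj: "inj_on (\<lambda>k. \<zeta> ^ k) {..<m}"
  proof (rule linorder_inj_onI)
    fix i j assume "i < j" "i \<in> {..<m}" "j \<in> {..<m}"
    moreover from this have "\<zeta> ^ j = \<zeta> ^ i * \<zeta> ^ (j - i)" by (simp flip: power_add)
    ultimately show "\<zeta> ^ i \<noteq> \<zeta> ^ j" using prim[of "j - i"] \<zeta>0 by auto
  qed auto
  have "(\<lambda>k. \<zeta> ^ k) ` {..<m} = {z. z ^ m = 1}"
  proof (rule card_subset_eq)
    show "finite {z::complex. z ^ m = 1}" using m by (intro finite_roots_unity) auto
    have "(\<zeta> ^ k) ^ m = 1" for k by (metis \<zeta>1 power_commutes power_mult power_one mult.commute)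
    then show "(\<lambda>k. \<zeta> ^ k) ` {..<m} \<subseteq> {z. z ^ m = 1}" by auto
    show "card ((\<lambda>k. \<zeta> ^ k) ` {..<m}) = card {z::complex. z ^ m = 1}"
      using m by (simp add: card_image[OF inj] card_roots_unity_eq)
  qed
  then have sub: "z \<in> ?S" if "z ^ m = 1" for z using pow that by (metis (mono_tags, lifting) imageE mem_Collect_eq)
  fix z assume "z \<in> carrier (root_group m)"
  then have z: "z ^ m = 1" by (simp add: root_group_def)
  then have "z \<noteq> 0" using m by (auto simp: zero_power)
  moreover have "inverse z ^ m = 1" using z by (simp add: power_inverse)
  ultimately have "z \<in> ?S \<and> inverse z \<in> ?S \<and> inverse z * z = 1 \<and> z * inverse z = 1"
    using z sub by auto
  then show "z \<in> Units (cyclotomic_integers \<zeta>)"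
    by (auto simp: Units_def cyclotomic_integers_def ring_of_type_algebra_def)
qed

lemma (in abelian_monoid) finsum_swap:
  assumes "finite A" "finite B" "\<And>x y. x \<in> A \<Longrightarrow> y \<in> B \<Longrightarrow> f x y \<in> carrier G"
  shows "(\<Oplus>x\<in>A. \<Oplus>y\<in>B. f x y) = (\<Oplus>y\<in>B. \<Oplus>x\<in>A. f x y)"
  using assms(1,3)
proof (induction A rule: finite_induct)
  case (insert a A)
  have "(\<Oplus>x\<in>insert a A. \<Oplus>y\<in>B. f x y) = (\<Oplus>y\<in>B. f a y) \<oplus> (\<Oplus>x\<in>A. \<Oplus>y\<in>B. f x y)"
    using insert by (intro finsum_insert) auto
  also have "(\<Oplus>x\<in>A. \<Oplus>y\<in>B. f x y) = (\<Oplus>y\<in>B. \<Oplus>x\<in>A. f x y)" using insert by auto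
  also have "(\<Oplus>y\<in>B. f a y) \<oplus> \<dots> = (\<Oplus>y\<in>B. f a y \<oplus> (\<Oplus>x\<in>A. f x y))"
    using insert by (intro finsum_addf[symmetric]) auto
  also have "\<dots> = (\<Oplus>y\<in>B. \<Oplus>x\<in>insert a A. f x y)"
    using insert by (intro finsum_cong') (auto intro!: finsum_insert[symmetric])
  finally show ?case .
qed simp

lemma group_ring_simps:
  "carrier (group_ring R G) = carrier G \<rightarrow>\<^sub>E carrier R"
  "a \<otimes>\<^bsub>group_ring R G\<^esub> b = (\<lambda>\<sigma>\<in>carrier G.
     \<Oplus>\<^bsub>R\<^esub>\<tau>\<in>carrier G. a \<tau> \<otimes>\<^bsub>R\<^esub> b (inv\<^bsub>G\<^esub> \<tau> \<otimes>\<^bsub>G\<^esub> \<sigma>))"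
  "\<one>\<^bsub>group_ring R G\<^esub> = (\<lambda>\<sigma>\<in>carrier G. if \<sigma> = \<one>\<^bsub>G\<^esub> then \<one>\<^bsub>R\<^esub> else \<zero>\<^bsub>R\<^esub>)"
  "\<zero>\<^bsub>group_ring R G\<^esub> = (\<lambda>\<sigma>\<in>carrier G. \<zero>\<^bsub>R\<^esub>)"
  "a \<oplus>\<^bsub>group_ring R G\<^esub> b = (\<lambda>\<sigma>\<in>carrier G. a \<sigma> \<oplus>\<^bsub>R\<^esub> b \<sigma>)"
  by (simp_all add: group_ring_def)

lemma ring_group_ring:
  assumes "cring R" "group G" "finite (carrier G)"
  shows "ring (group_ring R G)"
proof -
  interpret R: cring R by fact
  interpret G: group G by fact
  note [simp] = assms(3) group_ring_simps
  have ext: "a = b" if "a \<in> carrier G \<rightarrow>\<^sub>E carrier R" "b \<in> carrier G \<rightarrow>\<^sub>E carrier R"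
    "\<And>\<sigma>. \<sigma> \<in> carrier G \<Longrightarrow> a \<sigma> = b \<sigma>" for a b
    using that by (meson PiE_ext)
  have ab: "abelian_group (group_ring R G)"
  proof (rule abelian_groupI)
    fix x assume "x \<in> carrier (group_ring R G)"
    then have [simp]: "x \<sigma> \<in> carrier R" if "\<sigma> \<in> carrier G" for \<sigma> using that by auto
    have "(\<lambda>\<sigma>\<in>carrier G. \<ominus>\<^bsub>R\<^esub> x \<sigma>) \<in> carrier (group_ring R G) \<and>
      (\<lambda>\<sigma>\<in>carrier G. \<ominus>\<^bsub>R\<^esub> x \<sigma>) \<oplus>\<^bsub>group_ring R G\<^esub> x = \<zero>\<^bsub>group_ring R G\<^esub>"
      by (auto simp: R.l_neg intro!: restrict_ext)
    then show "\<exists>y\<in>carrier (group_ring R G). y \<oplus>\<^bsub>group_ring R G\<^esub> x = \<zero>\<^bsub>group_ring R G\<^esub>" by blast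
  qed (auto simp: R.a_ac PiE_def Pi_def extensional_def intro!: restrict_ext ext)
  have conv_closed: "x \<otimes>\<^bsub>group_ring R G\<^esub> y \<in> carrier G \<rightarrow>\<^sub>E carrier R"
    if "x \<in> carrier G \<rightarrow>\<^sub>E carrier R" "y \<in> carrier G \<rightarrow>\<^sub>E carrier R" for x y
    using that by (auto simp: PiE_def Pi_def intro!: R.finsum_closed)
  have mon: "monoid (group_ring R G)"
  proof (rule monoidI)
    fix x y z
    assume "x \<in> carrier (group_ring R G)" "y \<in> carrier (group_ring R G)" "z \<in> carrier (group_ring R G)"
    then have xyz: "x \<in> carrier G \<rightarrow>\<^sub>E carrier R" "y \<in> carrier G \<rightarrow>\<^sub>E carrier R"
      "z \<in> carrier G \<rightarrow>\<^sub>E carrier R" by auto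
    note [simp] = xyz[THEN PiE_mem]
    have "(\<Oplus>\<^bsub>R\<^esub>\<tau>\<in>carrier G. (\<Oplus>\<^bsub>R\<^esub>\<rho>\<in>carrier G. x \<rho> \<otimes>\<^bsub>R\<^esub> y (inv\<^bsub>G\<^esub> \<rho> \<otimes>\<^bsub>G\<^esub> \<tau>)) \<otimes>\<^bsub>R\<^esub> z (inv\<^bsub>G\<^esub> \<tau> \<otimes>\<^bsub>G\<^esub> \<sigma>)) =
      (\<Oplus>\<^bsub>R\<^esub>\<rho>\<in>carrier G. x \<rho> \<otimes>\<^bsub>R\<^esub> (\<Oplus>\<^bsub>R\<^esub>\<tau>\<in>carrier G. y \<tau> \<otimes>\<^bsub>R\<^esub> z (inv\<^bsub>G\<^esub> \<tau> \<otimes>\<^bsub>G\<^esub> (inv\<^bsub>G\<^esub> \<rho> \<otimes>\<^bsub>G\<^esub> \<sigma>))))"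
      (is "?L = ?R") if \<sigma>: "\<sigma> \<in> carrier G" for \<sigma>
    proof -
      have "?L = (\<Oplus>\<^bsub>R\<^esub>\<tau>\<in>carrier G. \<Oplus>\<^bsub>R\<^esub>\<rho>\<in>carrier G.
          x \<rho> \<otimes>\<^bsub>R\<^esub> y (inv\<^bsub>G\<^esub> \<rho> \<otimes>\<^bsub>G\<^esub> \<tau>) \<otimes>\<^bsub>R\<^esub> z (inv\<^bsub>G\<^esub> \<tau> \<otimes>\<^bsub>G\<^esub> \<sigma>))"
        using \<sigma> by (intro R.finsum_cong' refl R.finsum_ldistr) auto
      also have "\<dots> = (\<Oplus>\<^bsub>R\<^esub>\<rho>\<in>carrier G. \<Oplus>\<^bsub>R\<^esub>\<tau>\<in>carrier G.
          x \<rho> \<otimes>\<^bsub>R\<^esub> y (inv\<^bsub>G\<^esub> \<rho> \<otimes>\<^bsub>G\<^esub> \<tau>) \<otimes>\<^bsub>R\<^esub> z (inv\<^bsub>G\<^esub> \<tau> \<otimes>\<^bsub>G\<^esub> \<sigma>))"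
        using \<sigma> by (intro R.finsum_swap) auto
      also have "\<dots> = ?R"
      proof (intro R.finsum_cong' refl)
        fix \<rho> assume \<rho>: "\<rho> \<in> carrier G"
        have bij: "bij_betw (\<lambda>\<tau>. \<rho> \<otimes>\<^bsub>G\<^esub> \<tau>) (carrier G) (carrier G)"
          using \<rho> by (intro bij_betwI[where g = "\<lambda>\<tau>. inv\<^bsub>G\<^esub> \<rho> \<otimes>\<^bsub>G\<^esub> \<tau>"]) (auto simp flip: G.m_assoc)
        have "(\<Oplus>\<^bsub>R\<^esub>\<tau>\<in>carrier G. x \<rho> \<otimes>\<^bsub>R\<^esub> y (inv\<^bsub>G\<^esub> \<rho> \<otimes>\<^bsub>G\<^esub> \<tau>) \<otimes>\<^bsub>R\<^esub> z (inv\<^bsub>G\<^esub> \<tau> \<otimes>\<^bsub>G\<^esub> \<sigma>)) =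
          (\<Oplus>\<^bsub>R\<^esub>\<tau>\<in>(\<lambda>\<tau>. \<rho> \<otimes>\<^bsub>G\<^esub> \<tau>) ` carrier G. x \<rho> \<otimes>\<^bsub>R\<^esub> y (inv\<^bsub>G\<^esub> \<rho> \<otimes>\<^bsub>G\<^esub> \<tau>) \<otimes>\<^bsub>R\<^esub> z (inv\<^bsub>G\<^esub> \<tau> \<otimes>\<^bsub>G\<^esub> \<sigma>))"
          using bij by (simp add: bij_betw_def)
        also have "\<dots> = (\<Oplus>\<^bsub>R\<^esub>\<tau>\<in>carrier G. x \<rho> \<otimes>\<^bsub>R\<^esub> y (inv\<^bsub>G\<^esub> \<rho> \<otimes>\<^bsub>G\<^esub> (\<rho> \<otimes>\<^bsub>G\<^esub> \<tau>)) \<otimes>\<^bsub>R\<^esub>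
            z (inv\<^bsub>G\<^esub> (\<rho> \<otimes>\<^bsub>G\<^esub> \<tau>) \<otimes>\<^bsub>G\<^esub> \<sigma>))"
          using \<rho> \<sigma> bij by (intro R.finsum_reindex) (auto simp: bij_betw_def)
        also have "\<dots> = (\<Oplus>\<^bsub>R\<^esub>\<tau>\<in>carrier G. x \<rho> \<otimes>\<^bsub>R\<^esub>
            (y \<tau> \<otimes>\<^bsub>R\<^esub> z (inv\<^bsub>G\<^esub> \<tau> \<otimes>\<^bsub>G\<^esub> (inv\<^bsub>G\<^esub> \<rho> \<otimes>\<^bsub>G\<^esub> \<sigma>))))"
          using \<rho> \<sigma>
          by (intro R.finsum_cong' refl) (auto simp: G.inv_mult_group G.m_assoc R.m_assoc simp flip: G.m_assoc[of "inv\<^bsub>G\<^esub> \<rho>" \<rho>])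
        also have "\<dots> = x \<rho> \<otimes>\<^bsub>R\<^esub> (\<Oplus>\<^bsub>R\<^esub>\<tau>\<in>carrier G. y \<tau> \<otimes>\<^bsub>R\<^esub> z (inv\<^bsub>G\<^esub> \<tau> \<otimes>\<^bsub>G\<^esub> (inv\<^bsub>G\<^esub> \<rho> \<otimes>\<^bsub>G\<^esub> \<sigma>)))"
          using \<rho> \<sigma> by (intro R.finsum_rdistr[symmetric]) auto
        finally show "(\<Oplus>\<^bsub>R\<^esub>\<tau>\<in>carrier G. x \<rho> \<otimes>\<^bsub>R\<^esub> y (inv\<^bsub>G\<^esub> \<rho> \<otimes>\<^bsub>G\<^esub> \<tau>) \<otimes>\<^bsub>R\<^esub> z (inv\<^bsub>G\<^esub> \<tau> \<otimes>\<^bsub>G\<^esub> \<sigma>)) = \<dots>" .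
      qed (use \<sigma> in auto)
      finally show ?thesis .
    qed
    then show "x \<otimes>\<^bsub>group_ring R G\<^esub> y \<otimes>\<^bsub>group_ring R G\<^esub> z =
      x \<otimes>\<^bsub>group_ring R G\<^esub> (y \<otimes>\<^bsub>group_ring R G\<^esub> z)"
      by (auto simp: G.m_assoc[symmetric] intro!: restrict_ext cong: R.finsum_cong)
  next
    fix x assume "x \<in> carrier (group_ring R G)"
    then have x: "x \<in> carrier G \<rightarrow>\<^sub>E carrier R" by auto
    note [simp] = x[THEN PiE_mem]
    have "(\<Oplus>\<^bsub>R\<^esub>\<tau>\<in>carrier G. (if \<tau> = \<one>\<^bsub>G\<^esub> then \<one>\<^bsub>R\<^esub> else \<zero>\<^bsub>R\<^esub>) \<otimes>\<^bsub>R\<^esub> x (inv\<^bsub>G\<^esub> \<tau> \<otimes>\<^bsub>G\<^esub> \<sigma>)) = x \<sigma>"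
      if \<sigma>: "\<sigma> \<in> carrier G" for \<sigma>
    proof -
      have "(\<Oplus>\<^bsub>R\<^esub>\<tau>\<in>carrier G. (if \<tau> = \<one>\<^bsub>G\<^esub> then \<one>\<^bsub>R\<^esub> else \<zero>\<^bsub>R\<^esub>) \<otimes>\<^bsub>R\<^esub> x (inv\<^bsub>G\<^esub> \<tau> \<otimes>\<^bsub>G\<^esub> \<sigma>)) =
        (\<Oplus>\<^bsub>R\<^esub>\<tau>\<in>carrier G. if \<one>\<^bsub>G\<^esub> = \<tau> then x \<sigma> else \<zero>\<^bsub>R\<^esub>)"
        using \<sigma> by (intro R.finsum_cong') auto
      also have "\<dots> = x \<sigma>" using \<sigma> by (intro R.finsum_singleton) auto
      finally show ?thesis .
    qed
    then show "\<one>\<^bsub>group_ring R G\<^esub> \<otimes>\<^bsub>group_ring R G\<^esub> x = x"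
      using x by (intro ext conv_closed) (auto cong: R.finsum_cong)
    have "(\<Oplus>\<^bsub>R\<^esub>\<tau>\<in>carrier G. x \<tau> \<otimes>\<^bsub>R\<^esub> (if inv\<^bsub>G\<^esub> \<tau> \<otimes>\<^bsub>G\<^esub> \<sigma> = \<one>\<^bsub>G\<^esub> then \<one>\<^bsub>R\<^esub> else \<zero>\<^bsub>R\<^esub>)) = x \<sigma>"
      if \<sigma>: "\<sigma> \<in> carrier G" for \<sigma>
    proof -
      have "(\<Oplus>\<^bsub>R\<^esub>\<tau>\<in>carrier G. x \<tau> \<otimes>\<^bsub>R\<^esub> (if inv\<^bsub>G\<^esub> \<tau> \<otimes>\<^bsub>G\<^esub> \<sigma> = \<one>\<^bsub>G\<^esub> then \<one>\<^bsub>R\<^esub> else \<zero>\<^bsub>R\<^esub>)) =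
        (\<Oplus>\<^bsub>R\<^esub>\<tau>\<in>carrier G. if \<sigma> = \<tau> then x \<tau> else \<zero>\<^bsub>R\<^esub>)"
        using \<sigma> by (intro R.finsum_cong') (auto simp: G.l_inv, metis G.inv_closed G.inv_equality G.inv_inv)
      also have "\<dots> = x \<sigma>" using \<sigma> by (intro R.finsum_singleton) auto
      finally show ?thesis .
    qed
    then show "x \<otimes>\<^bsub>group_ring R G\<^esub> \<one>\<^bsub>group_ring R G\<^esub> = x"
      using x by (intro ext conv_closed) (auto cong: R.finsum_cong)
  next
    show "x \<otimes>\<^bsub>group_ring R G\<^esub> y \<in> carrier (group_ring R G)"
      if "x \<in> carrier (group_ring R G)" "y \<in> carrier (group_ring R G)" for x y
      using conv_closed that by (simp only: group_ring_simps(1))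
  qed auto
  show ?thesis
  proof (rule ringI[OF ab mon])
    fix x y z
    assume "x \<in> carrier (group_ring R G)" "y \<in> carrier (group_ring R G)" "z \<in> carrier (group_ring R G)"
    then have xyz: "x \<in> carrier G \<rightarrow>\<^sub>E carrier R" "y \<in> carrier G \<rightarrow>\<^sub>E carrier R"
      "z \<in> carrier G \<rightarrow>\<^sub>E carrier R" by auto
    note [simp] = xyz[THEN PiE_mem]
    show "(x \<oplus>\<^bsub>group_ring R G\<^esub> y) \<otimes>\<^bsub>group_ring R G\<^esub> z =
      x \<otimes>\<^bsub>group_ring R G\<^esub> z \<oplus>\<^bsub>group_ring R G\<^esub> y \<otimes>\<^bsub>group_ring R G\<^esub> z"
      by (auto intro!: restrict_ext simp: R.l_distr simp flip: R.finsum_addf cong: R.finsum_cong)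
    show "z \<otimes>\<^bsub>group_ring R G\<^esub> (x \<oplus>\<^bsub>group_ring R G\<^esub> y) =
      z \<otimes>\<^bsub>group_ring R G\<^esub> x \<oplus>\<^bsub>group_ring R G\<^esub> z \<otimes>\<^bsub>group_ring R G\<^esub> y"
      by (auto intro!: restrict_ext simp: R.r_distr simp flip: R.finsum_addf cong: R.finsum_cong)
  qed
qed


lemma cring_group_ring:
  assumes "cring R" "comm_group G" "finite (carrier G)"
  shows "cring (group_ring R G)"
proof -
  interpret R: cring R by fact
  interpret G: comm_group G by fact
  interpret RG: ring "group_ring R G" by (rule ring_group_ring) (use assms G.is_group in auto)
  show ?thesis
  proof (intro cring.intro comm_monoid.intro comm_monoid_axioms.intro RG.ring_axioms RG.monoid_axioms)
    fix x y assume "x \<in> carrier (group_ring R G)" "y \<in> carrier (group_ring R G)"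
    then have xy: "x \<in> carrier G \<rightarrow>\<^sub>E carrier R" "y \<in> carrier G \<rightarrow>\<^sub>E carrier R"
      by (auto simp: group_ring_simps)
    note [simp] = xy[THEN PiE_mem]
    have "(\<Oplus>\<^bsub>R\<^esub>\<tau>\<in>carrier G. x \<tau> \<otimes>\<^bsub>R\<^esub> y (inv\<^bsub>G\<^esub> \<tau> \<otimes>\<^bsub>G\<^esub> \<sigma>)) =
      (\<Oplus>\<^bsub>R\<^esub>\<tau>\<in>carrier G. y \<tau> \<otimes>\<^bsub>R\<^esub> x (inv\<^bsub>G\<^esub> \<tau> \<otimes>\<^bsub>G\<^esub> \<sigma>))" if \<sigma>: "\<sigma> \<in> carrier G" for \<sigma>
    proof -
      have inv2: "inv\<^bsub>G\<^esub> (inv\<^bsub>G\<^esub> \<tau> \<otimes>\<^bsub>G\<^esub> \<sigma>) \<otimes>\<^bsub>G\<^esub> \<sigma> = \<tau>" if "\<tau> \<in> carrier G" for \<tau>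
        using that \<sigma> by (simp add: G.inv_mult_group G.m_assoc G.m_comm[of \<tau> \<sigma>])
          (simp flip: G.m_assoc)
      have bij: "bij_betw (\<lambda>\<tau>. inv\<^bsub>G\<^esub> \<tau> \<otimes>\<^bsub>G\<^esub> \<sigma>) (carrier G) (carrier G)"
        using \<sigma> inv2 by (intro bij_betwI[where g = "\<lambda>\<tau>. inv\<^bsub>G\<^esub> \<tau> \<otimes>\<^bsub>G\<^esub> \<sigma>"]) auto
      have "(\<Oplus>\<^bsub>R\<^esub>\<tau>\<in>carrier G. y \<tau> \<otimes>\<^bsub>R\<^esub> x (inv\<^bsub>G\<^esub> \<tau> \<otimes>\<^bsub>G\<^esub> \<sigma>)) =
        (\<Oplus>\<^bsub>R\<^esub>\<tau>\<in>(\<lambda>\<tau>. inv\<^bsub>G\<^esub> \<tau> \<otimes>\<^bsub>G\<^esub> \<sigma>) ` carrier G. y \<tau> \<otimes>\<^bsub>R\<^esub> x (inv\<^bsub>G\<^esub> \<tau> \<otimes>\<^bsub>G\<^esub> \<sigma>))"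
        using bij by (simp add: bij_betw_def)
      also have "\<dots> = (\<Oplus>\<^bsub>R\<^esub>\<tau>\<in>carrier G. y (inv\<^bsub>G\<^esub> \<tau> \<otimes>\<^bsub>G\<^esub> \<sigma>) \<otimes>\<^bsub>R\<^esub>
          x (inv\<^bsub>G\<^esub> (inv\<^bsub>G\<^esub> \<tau> \<otimes>\<^bsub>G\<^esub> \<sigma>) \<otimes>\<^bsub>G\<^esub> \<sigma>))"
        using \<sigma> bij by (intro R.finsum_reindex) (auto simp: bij_betw_def)
      also have "\<dots> = (\<Oplus>\<^bsub>R\<^esub>\<tau>\<in>carrier G. x \<tau> \<otimes>\<^bsub>R\<^esub> y (inv\<^bsub>G\<^esub> \<tau> \<otimes>\<^bsub>G\<^esub> \<sigma>))"
        using \<sigma> inv2 by (intro R.finsum_cong') (auto simp: R.m_comm)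
      finally show ?thesis ..
    qed
    then show "x \<otimes>\<^bsub>group_ring R G\<^esub> y = y \<otimes>\<^bsub>group_ring R G\<^esub> x"
      by (auto simp: group_ring_simps intro!: restrict_ext)
  qed
qed

lemma gr_incl_ring_hom:
  assumes "cring R" "group G" "finite (carrier G)" "subgroup H G"
  shows "gr_incl R G H \<in> ring_hom (group_ring R (G\<lparr>carrier := H\<rparr>)) (group_ring R G)"
proof -
  interpret R: cring R by fact
  interpret G: group G by fact
  interpret H: subgroup H G by fact
  have inv_H: "inv\<^bsub>G\<lparr>carrier := H\<rparr>\<^esub> \<tau> = inv\<^bsub>G\<^esub> \<tau>" if "\<tau> \<in> H" for \<tau>
    using that assms(4) by (simp add: G.m_inv_consistent)
  show ?thesis
  proof (rule ring_hom_memI)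
    fix x y
    assume "x \<in> carrier (group_ring R (G\<lparr>carrier := H\<rparr>))" "y \<in> carrier (group_ring R (G\<lparr>carrier := H\<rparr>))"
    then have xy: "x \<in> H \<rightarrow>\<^sub>E carrier R" "y \<in> H \<rightarrow>\<^sub>E carrier R"
      by (auto simp: group_ring_simps)
    note [simp] = xy[THEN PiE_mem]
    show "gr_incl R G H x \<in> carrier (group_ring R G)"
      by (auto simp: gr_incl_def group_ring_simps)
    show "gr_incl R G H (x \<oplus>\<^bsub>group_ring R (G\<lparr>carrier := H\<rparr>)\<^esub> y) =
      gr_incl R G H x \<oplus>\<^bsub>group_ring R G\<^esub> gr_incl R G H y"
      by (auto simp: gr_incl_def group_ring_simps intro!: restrict_ext)
    have "(\<Oplus>\<^bsub>R\<^esub>\<tau>\<in>carrier G. gr_incl R G H x \<tau> \<otimes>\<^bsub>R\<^esub> gr_incl R G H y (inv\<^bsub>G\<^esub> \<tau> \<otimes>\<^bsub>G\<^esub> \<sigma>)) =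
      (if \<sigma> \<in> H then \<Oplus>\<^bsub>R\<^esub>\<tau>\<in>H. x \<tau> \<otimes>\<^bsub>R\<^esub> y (inv\<^bsub>G\<lparr>carrier := H\<rparr>\<^esub> \<tau> \<otimes>\<^bsub>G\<^esub> \<sigma>) else \<zero>\<^bsub>R\<^esub>)"
      if \<sigma>: "\<sigma> \<in> carrier G" for \<sigma>
    proof -
      have "\<sigma> \<in> H" if "\<tau> \<in> H" "inv\<^bsub>G\<^esub> \<tau> \<otimes>\<^bsub>G\<^esub> \<sigma> \<in> H" for \<tau>
      proof -
        have "\<tau> \<otimes>\<^bsub>G\<^esub> (inv\<^bsub>G\<^esub> \<tau> \<otimes>\<^bsub>G\<^esub> \<sigma>) \<in> H" using that by (rule H.m_closed)
        then show ?thesis using that \<sigma> by (simp flip: G.m_assoc)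
      qed
      then have "(\<Oplus>\<^bsub>R\<^esub>\<tau>\<in>carrier G. gr_incl R G H x \<tau> \<otimes>\<^bsub>R\<^esub> gr_incl R G H y (inv\<^bsub>G\<^esub> \<tau> \<otimes>\<^bsub>G\<^esub> \<sigma>)) =
        (\<Oplus>\<^bsub>R\<^esub>\<tau>\<in>H. if \<sigma> \<in> H then x \<tau> \<otimes>\<^bsub>R\<^esub> y (inv\<^bsub>G\<lparr>carrier := H\<rparr>\<^esub> \<tau> \<otimes>\<^bsub>G\<^esub> \<sigma>) else \<zero>\<^bsub>R\<^esub>)"
        using \<sigma> H.subset assms(3)
        by (intro R.add.finprod_mono_neutral_cong_right) (auto simp: gr_incl_def inv_H)
      then show ?thesis by (auto simp: R.finsum_zero)
    qed
    then show "gr_incl R G H (x \<otimes>\<^bsub>group_ring R (G\<lparr>carrier := H\<rparr>)\<^esub> y) =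
      gr_incl R G H x \<otimes>\<^bsub>group_ring R G\<^esub> gr_incl R G H y"
      by (subst gr_incl_def) (auto simp: group_ring_simps intro!: restrict_ext)
  qed (auto simp: gr_incl_def group_ring_simps intro!: restrict_ext)
qed

lemma char_elem_coeff:
  assumes "cring R" "group \<Gamma>" "finite (carrier \<Gamma>)"
    and "primitive_root_of_unity m \<zeta>" "h \<in> ring_hom (cyclotomic_integers \<zeta>) R" "\<chi> \<in> characters m \<Gamma>"
  shows "char_elem R \<Gamma> h \<chi> = (\<lambda>\<sigma>\<in>carrier \<Gamma>. h (inverse (\<chi> \<sigma>)))"
proof -
  interpret R: cring R by fact
  interpret G: group \<Gamma> by fact
  interpret RG: ring "group_ring R \<Gamma>" by (rule ring_group_ring) fact+
  have h [simp]: "h (inverse (\<chi> \<sigma>)) \<in> carrier R" if "\<sigma> \<in> carrier \<Gamma>" for \<sigma>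
  proof -
    have "\<chi> \<sigma> ^ m = 1" using assms(6) that by (auto simp: characters_def hom_def root_group_def)
    then have "inverse (\<chi> \<sigma>) \<in> carrier (root_group m)" by (simp add: root_group_def power_inverse)
    then show ?thesis
      using root_group_subset_Units[OF assms(4)] assms(5) by (auto simp: Units_def ring_hom_def)
  qed
  have "(\<Oplus>\<^bsub>group_ring R \<Gamma>\<^esub>\<sigma>\<in>A. gr_monom R \<Gamma> (h (inverse (\<chi> \<sigma>))) \<sigma>) =
    (\<lambda>\<sigma>\<in>carrier \<Gamma>. if \<sigma> \<in> A then h (inverse (\<chi> \<sigma>)) else \<zero>\<^bsub>R\<^esub>)"
    if "finite A" "A \<subseteq> carrier \<Gamma>" for A
    using that
  proof (induction A rule: finite_induct)
    case (insert a A)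
    have "gr_monom R \<Gamma> (h (inverse (\<chi> \<sigma>))) \<sigma> \<in> carrier (group_ring R \<Gamma>)" if "\<sigma> \<in> insert a A" for \<sigma>
      using insert that by (auto simp: gr_monom_def group_ring_simps)
    then have "(\<Oplus>\<^bsub>group_ring R \<Gamma>\<^esub>\<sigma>\<in>insert a A. gr_monom R \<Gamma> (h (inverse (\<chi> \<sigma>))) \<sigma>) =
      gr_monom R \<Gamma> (h (inverse (\<chi> a))) a \<oplus>\<^bsub>group_ring R \<Gamma>\<^esub>
      (\<Oplus>\<^bsub>group_ring R \<Gamma>\<^esub>\<sigma>\<in>A. gr_monom R \<Gamma> (h (inverse (\<chi> \<sigma>))) \<sigma>)"
      using insert by (intro RG.finsum_insert) auto
    also have "(\<Oplus>\<^bsub>group_ring R \<Gamma>\<^esub>\<sigma>\<in>A. gr_monom R \<Gamma> (h (inverse (\<chi> \<sigma>))) \<sigma>) =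
      (\<lambda>\<sigma>\<in>carrier \<Gamma>. if \<sigma> \<in> A then h (inverse (\<chi> \<sigma>)) else \<zero>\<^bsub>R\<^esub>)"
      using insert by auto
    finally show ?case
      using insert by (auto simp: group_ring_simps gr_monom_def intro!: restrict_ext)
  qed (simp add: group_ring_simps)
  from this[of "carrier \<Gamma>"] show ?thesis
    using assms(3) by (auto simp: char_elem_def intro!: restrict_ext)
qed

lemma module_restrict_module:
  assumes "cring R" "comm_group G" "finite (carrier G)" "subgroup H G" "module (group_ring R G) M"
  shows "module (group_ring R (G\<lparr>carrier := H\<rparr>)) (restrict_module R G H M)"
proof -
  interpret G: comm_group G by fact
  interpret M: module "group_ring R G" M by fact
  have hom: "gr_incl R G H \<in> ring_hom (group_ring R (G\<lparr>carrier := H\<rparr>)) (group_ring R G)"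
    by (rule gr_incl_ring_hom) (use assms G.is_group in auto)
  have "H \<subseteq> carrier G" using assms(4) by (rule subgroup.subset)
  then have cr: "cring (group_ring R (G\<lparr>carrier := H\<rparr>))"
    using assms subgroup.mem_carrier[OF assms(4)] G.m_comm
    by (intro cring_group_ring group.group_comm_groupI G.subgroup_imp_group) (auto intro: finite_subset)
  have ab: "abelian_group (restrict_module R G H M)"
    using M.M.abelian_group_axioms
    by (auto simp: restrict_module_def abelian_group_def abelian_monoid_def abelian_group_axioms_def)
  show ?thesis
    by (rule moduleI[OF cr ab])
      (auto simp: restrict_module_def ring_hom_memE[OF hom] M.smult_l_distr M.smult_r_distr M.smult_assoc1)
qed

end

theory Submission
  imports Defs
begin

text \<open>
  Let \<open>g\<close> generate \<open>G\<close>, put \<open>u = \<psi>(g)\<close>, \<open>N = p\<^sup>n\<^sup>-\<^sup>1\<close>, \<open>d = g - u\<close>, \<open>s = \<Sum>\<^sub>l\<^sub><\<^sub>N u\<^sup>-\<^sup>l g\<^sup>l\<close>, and let \<open>t\<close> be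
  \<open>\<epsilon>\<^sub>\<chi>\<close> for the restriction \<open>\<chi>\<close> of \<open>\<psi>\<close> to \<open>H\<close>. Then \<open>M\<^sup>\<psi> = ker d\<close>, \<open>\<epsilon>\<^sub>\<psi> = s t\<close>, and the hypothesis
  says \<open>ker (d s) = t M\<close>. As \<open>M\<close> is finite, this gives \<open>ker t = d s M\<close> by counting, from which
  \<open>ker d = s t M + t (ker d)\<close>. On \<open>ker d\<close> the element \<open>t\<close> acts as \<open>p\<close> and \<open>s t\<close> as \<open>p\<^sup>n\<close>, so iterating
  \<open>n\<close> times yields \<open>M\<^sup>\<psi> = \<epsilon>\<^sub>\<psi> M\<close>.

  For the product formula, \<open>\<Prod>\<^sub>k (g - \<zeta>\<^sup>k) = 0\<close> on \<open>M\<close>, and \<open>\<epsilon>\<^sub>\<psi>\<close> is up to a unit the product of the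
  factors other than \<open>g - u\<close>. So \<open>ker (g - \<zeta>\<^sup>k)\<close> is contained in \<open>\<Prod>\<^sub>j\<^sub><\<^sub>k (g - \<zeta>\<^sup>j) M\<close>, and it is
  the kernel of each step of the filtration of \<open>M\<close> by these images.
\<close>

section \<open>Images and kernels of scalars on a finite module\<close>

lemma (in module) smult_eq_iff_diff:
  assumes "a \<in> carrier R" "x \<in> carrier M" "y \<in> carrier M"
  shows "a \<odot>\<^bsub>M\<^esub> x = a \<odot>\<^bsub>M\<^esub> y \<longleftrightarrow> a \<odot>\<^bsub>M\<^esub> (x \<ominus>\<^bsub>M\<^esub> y) = \<zero>\<^bsub>M\<^esub>"
  using assms by (simp add: a_minus_def smult_r_distr smult_r_minus M.r_neg M.add.inv_equality)
    (metis M.add.inv_closed M.minus_equality M.minus_minus M.r_neg smult_closed)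

text \<open>The homomorphism theorem in counting form, for multiplication by \<open>a\<close> from
  \<open>b M\<close> onto \<open>a b M\<close>: every fibre is a translate of the kernel
  \<open>?K\<close>, so all fibres have the same size.\<close>

lemma (in module) card_smult_image:
  assumes fin: "finite (carrier M)" and a: "a \<in> carrier R" and b: "b \<in> carrier R"
  shows "card ((\<lambda>m. b \<odot>\<^bsub>M\<^esub> m) ` carrier M) =
    card ((\<lambda>m. (a \<otimes> b) \<odot>\<^bsub>M\<^esub> m) ` carrier M) *
    card {m \<in> (\<lambda>m. b \<odot>\<^bsub>M\<^esub> m) ` carrier M. a \<odot>\<^bsub>M\<^esub> m = \<zero>\<^bsub>M\<^esub>}"
proof -
  let ?B = "(\<lambda>m. b \<odot>\<^bsub>M\<^esub> m) ` carrier M"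
  let ?K = "{m \<in> ?B. a \<odot>\<^bsub>M\<^esub> m = \<zero>\<^bsub>M\<^esub>}"
  have B: "?B \<subseteq> carrier M" and fB: "finite ?B"
    using b fin by auto
  have diff: "x \<ominus>\<^bsub>M\<^esub> y \<in> ?B" and add: "x \<oplus>\<^bsub>M\<^esub> y \<in> ?B" if "x \<in> ?B" "y \<in> ?B" for x y
  proof -
    from that obtain x' y' where xy: "x' \<in> carrier M" "y' \<in> carrier M"
      "x = b \<odot>\<^bsub>M\<^esub> x'" "y = b \<odot>\<^bsub>M\<^esub> y'" by auto
    then have "x \<ominus>\<^bsub>M\<^esub> y = b \<odot>\<^bsub>M\<^esub> (x' \<ominus>\<^bsub>M\<^esub> y')" "x \<oplus>\<^bsub>M\<^esub> y = b \<odot>\<^bsub>M\<^esub> (x' \<oplus>\<^bsub>M\<^esub> y')"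
      using b by (simp_all add: a_minus_def smult_r_distr smult_r_minus)
    then show "x \<ominus>\<^bsub>M\<^esub> y \<in> ?B" "x \<oplus>\<^bsub>M\<^esub> y \<in> ?B" using xy by auto
  qed
  have fibre: "card {x \<in> ?B. a \<odot>\<^bsub>M\<^esub> x = y} = card ?K" if y: "y \<in> (\<lambda>m. a \<odot>\<^bsub>M\<^esub> m) ` ?B" for y
  proof -
    from y obtain x0 where x0: "x0 \<in> ?B" "y = a \<odot>\<^bsub>M\<^esub> x0" by blast
    then have x0c: "x0 \<in> carrier M" using B by blast
    have "bij_betw (\<lambda>x. x \<oplus>\<^bsub>M\<^esub> x0) ?K {x \<in> ?B. a \<odot>\<^bsub>M\<^esub> x = y}"
    proof (rule bij_betwI[where g = "\<lambda>x. x \<ominus>\<^bsub>M\<^esub> x0"])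
      show "(\<lambda>x. x \<oplus>\<^bsub>M\<^esub> x0) \<in> ?K \<rightarrow> {x \<in> ?B. a \<odot>\<^bsub>M\<^esub> x = y}"
      proof
        fix k assume k: "k \<in> ?K"
        then have kc: "k \<in> carrier M" using B by blast
        then show "k \<oplus>\<^bsub>M\<^esub> x0 \<in> {x \<in> ?B. a \<odot>\<^bsub>M\<^esub> x = y}"
          using k x0 x0c a add[of k x0] by (simp add: smult_r_distr)
      qed
      show "(\<lambda>x. x \<ominus>\<^bsub>M\<^esub> x0) \<in> {x \<in> ?B. a \<odot>\<^bsub>M\<^esub> x = y} \<rightarrow> ?K"
      proof
        fix k assume k: "k \<in> {x \<in> ?B. a \<odot>\<^bsub>M\<^esub> x = y}"
        then have kc: "k \<in> carrier M" using B by blast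
        then show "k \<ominus>\<^bsub>M\<^esub> x0 \<in> ?K"
          using k x0 x0c a diff[of k x0] smult_eq_iff_diff[of a k x0] by simp
      qed
    next
      fix k assume "k \<in> ?K"
      then have "k \<in> carrier M" using B by blast
      then show "(k \<oplus>\<^bsub>M\<^esub> x0) \<ominus>\<^bsub>M\<^esub> x0 = k"
        using x0c by (simp add: a_minus_def M.a_assoc M.r_neg)
    next
      fix k assume "k \<in> {x \<in> ?B. a \<odot>\<^bsub>M\<^esub> x = y}"
      then have "k \<in> carrier M" using B by blast
      then show "(k \<ominus>\<^bsub>M\<^esub> x0) \<oplus>\<^bsub>M\<^esub> x0 = k"
        using x0c by (simp add: a_minus_def M.a_assoc M.l_neg)
    qed
    then show ?thesis by (simp add: bij_betw_same_card)
  qed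
  have "card ?B = (\<Sum>y\<in>(\<lambda>m. a \<odot>\<^bsub>M\<^esub> m) ` ?B. card {x \<in> ?B. a \<odot>\<^bsub>M\<^esub> x = y})"
    using sum.image_gen[OF fB, of "\<lambda>_. 1::nat" "\<lambda>m. a \<odot>\<^bsub>M\<^esub> m"] by simp
  also have "\<dots> = (\<Sum>y\<in>(\<lambda>m. a \<odot>\<^bsub>M\<^esub> m) ` ?B. card ?K)"
    using fibre by (intro sum.cong) auto
  also have "\<dots> = card ((\<lambda>m. a \<odot>\<^bsub>M\<^esub> m) ` ?B) * card ?K" by simp
  also have "(\<lambda>m. a \<odot>\<^bsub>M\<^esub> m) ` ?B = (\<lambda>m. (a \<otimes> b) \<odot>\<^bsub>M\<^esub> m) ` carrier M"
    using a b by (auto simp: image_image smult_assoc1 intro!: image_cong)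
  finally show ?thesis .
qed

lemma (in module) card_smult_image_kernel:
  assumes "finite (carrier M)" "a \<in> carrier R"
  shows "card (carrier M) = card ((\<lambda>m. a \<odot>\<^bsub>M\<^esub> m) ` carrier M) * card {m \<in> carrier M. a \<odot>\<^bsub>M\<^esub> m = \<zero>\<^bsub>M\<^esub>}"
proof -
  have "(\<lambda>m. \<one> \<odot>\<^bsub>M\<^esub> m) ` carrier M = carrier M" by simp
  then show ?thesis using card_smult_image[OF assms R.one_closed] assms by simp
qed

text \<open>The submodules \<open>b k M\<close> descend from \<open>M\<close> to zero, and
  \<open>a k\<close> maps \<open>b k M\<close> onto \<open>b (k + 1) M\<close>. By
  \<open>ker\<close> the whole kernel of \<open>a k\<close> already lies in \<open>b k M\<close>, so
  each step divides the order by exactly the size of that kernel.\<close>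

lemma (in module) card_eq_prod_kernels:
  assumes fin: "finite (carrier M)"
    and a: "\<And>k. k < q \<Longrightarrow> a k \<in> carrier R" and b: "\<And>k. k \<le> q \<Longrightarrow> b k \<in> carrier R"
    and b0: "b 0 = \<one>" and bSuc: "\<And>k. k < q \<Longrightarrow> b (Suc k) = a k \<otimes> b k" and bq: "b q = \<zero>"
    and ker: "\<And>k m. k < q \<Longrightarrow> m \<in> carrier M \<Longrightarrow> a k \<odot>\<^bsub>M\<^esub> m = \<zero>\<^bsub>M\<^esub> \<Longrightarrow> m \<in> (\<lambda>m. b k \<odot>\<^bsub>M\<^esub> m) ` carrier M"
  shows "card (carrier M) = (\<Prod>k<q. card {m \<in> carrier M. a k \<odot>\<^bsub>M\<^esub> m = \<zero>\<^bsub>M\<^esub>})"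
proof -
  have "card (carrier M) = card ((\<lambda>m. b k \<odot>\<^bsub>M\<^esub> m) ` carrier M) *
    (\<Prod>j<k. card {m \<in> carrier M. a j \<odot>\<^bsub>M\<^esub> m = \<zero>\<^bsub>M\<^esub>})" if "k \<le> q" for k
    using that
  proof (induction k)
    case 0
    then show ?case by (simp add: b0)
  next
    case (Suc k)
    have "{m \<in> (\<lambda>m. b k \<odot>\<^bsub>M\<^esub> m) ` carrier M. a k \<odot>\<^bsub>M\<^esub> m = \<zero>\<^bsub>M\<^esub>} =
      {m \<in> carrier M. a k \<odot>\<^bsub>M\<^esub> m = \<zero>\<^bsub>M\<^esub>}"
      using Suc.prems ker[of k] b[of k] by auto
    then show ?case
      using Suc card_smult_image[OF fin a[of k] b[of k]] by (simp add: bSuc ac_simps)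
  qed
  from this[of q] show ?thesis by (simp add: bq image_constant_conv)
    (auto simp: image_constant_conv)
qed

text \<open>The argument from \<open>ker (d s) = t M\<close> to \<open>ker d\<close> inside
  \<open>s t M\<close>, for abstract \<open>d\<close>, \<open>s\<close>, \<open>t\<close>. The
  assumption \<open>pow\<close> ends the iteration: on \<open>ker d\<close> the power
  \<open>t^(k+1)\<close> acts as \<open>s t\<close>.\<close>

lemma (in module) kernel_subset_image_mult:
  assumes fin: "finite (carrier M)"
    and [simp]: "d \<in> carrier R" "s \<in> carrier R" "t \<in> carrier R"
    and dst: "t \<otimes> (d \<otimes> s) = \<zero>"
    and ker: "\<And>m. m \<in> carrier M \<Longrightarrow> (d \<otimes> s) \<odot>\<^bsub>M\<^esub> m = \<zero>\<^bsub>M\<^esub> \<Longrightarrow> m \<in> (\<lambda>m. t \<odot>\<^bsub>M\<^esub> m) ` carrier M"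
    and pow: "\<And>m. m \<in> carrier M \<Longrightarrow> d \<odot>\<^bsub>M\<^esub> m = \<zero>\<^bsub>M\<^esub> \<Longrightarrow> s \<odot>\<^bsub>M\<^esub> m = (t [^] (k::nat)) \<odot>\<^bsub>M\<^esub> m"
    and m: "m \<in> carrier M" "d \<odot>\<^bsub>M\<^esub> m = \<zero>\<^bsub>M\<^esub>"
  shows "m \<in> (\<lambda>m. (s \<otimes> t) \<odot>\<^bsub>M\<^esub> m) ` carrier M"
proof -
  let ?b = "d \<otimes> s" and ?K = "{m \<in> carrier M. d \<odot>\<^bsub>M\<^esub> m = \<zero>\<^bsub>M\<^esub>}"
  let ?kt = "{m \<in> carrier M. t \<odot>\<^bsub>M\<^esub> m = \<zero>\<^bsub>M\<^esub>}"
  have tM: "(\<lambda>m. t \<odot>\<^bsub>M\<^esub> m) ` carrier M = {m \<in> carrier M. ?b \<odot>\<^bsub>M\<^esub> m = \<zero>\<^bsub>M\<^esub>}"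
  proof -
    have "?b \<odot>\<^bsub>M\<^esub> (t \<odot>\<^bsub>M\<^esub> x) = \<zero>\<^bsub>M\<^esub>" if "x \<in> carrier M" for x
      using that dst by (simp flip: smult_assoc1 add: R.m_comm[of "d \<otimes> s" t])
    then show ?thesis using ker by auto
  qed
  \<comment> \<open>Counting \<open>M\<close> once along \<open>t\<close> and once along
    \<open>d s\<close>, whose kernel is \<open>t M\<close>, and cancelling the order of
    \<open>t M\<close> shows that \<open>d s M\<close> and \<open>ker t\<close> have equal size. One
    contains the other, so they coincide.\<close>
  have "card (carrier M) = card ((\<lambda>m. t \<odot>\<^bsub>M\<^esub> m) ` carrier M) * card ?kt"
    by (rule card_smult_image_kernel) (use fin in auto)
  moreover have "card (carrier M) =
      card ((\<lambda>m. ?b \<odot>\<^bsub>M\<^esub> m) ` carrier M) * card ((\<lambda>m. t \<odot>\<^bsub>M\<^esub> m) ` carrier M)"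
    unfolding tM by (rule card_smult_image_kernel) (use fin in auto)
  moreover have "card ((\<lambda>m. t \<odot>\<^bsub>M\<^esub> m) ` carrier M) > 0"
    using fin M.zero_closed by (auto simp: card_gt_0_iff)
  moreover have "k = j" if "c = i * j" "c = k * i" "i > 0" for c i j k :: nat
    using that by simp
  ultimately have "card ((\<lambda>m. ?b \<odot>\<^bsub>M\<^esub> m) ` carrier M) = card ?kt" by blast
  moreover have "(\<lambda>m. ?b \<odot>\<^bsub>M\<^esub> m) ` carrier M \<subseteq> ?kt"
    using dst by (auto simp flip: smult_assoc1)
  ultimately have kt: "(\<lambda>m. ?b \<odot>\<^bsub>M\<^esub> m) ` carrier M = ?kt"
    using fin by (intro card_subset_eq) auto
  \<comment> \<open>Write \<open>m = t m'\<close>. Then \<open>d m'\<close> is killed by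
    \<open>t\<close>, hence equals \<open>d s x\<close> for some \<open>x\<close>, and
    \<open>y = m' - s x\<close> lies in \<open>ker d\<close>.\<close>
  have step: "\<exists>x\<in>carrier M. \<exists>y\<in>?K. m = (s \<otimes> t) \<odot>\<^bsub>M\<^esub> x \<oplus>\<^bsub>M\<^esub> t \<odot>\<^bsub>M\<^esub> y" if m: "m \<in> ?K" for m
  proof -
    have "?b \<odot>\<^bsub>M\<^esub> m = \<zero>\<^bsub>M\<^esub>"
      using m by (simp add: R.m_comm[of d s] smult_assoc1)
    then obtain m' where m': "m' \<in> carrier M" "m = t \<odot>\<^bsub>M\<^esub> m'" using ker m by auto
    then have "t \<odot>\<^bsub>M\<^esub> (d \<odot>\<^bsub>M\<^esub> m') = \<zero>\<^bsub>M\<^esub>"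
      using m by (simp flip: smult_assoc1 add: R.m_comm[of t d])
    then have "d \<odot>\<^bsub>M\<^esub> m' \<in> (\<lambda>m. ?b \<odot>\<^bsub>M\<^esub> m) ` carrier M"
      using kt m' by auto
    then obtain x where x: "x \<in> carrier M" "d \<odot>\<^bsub>M\<^esub> m' = d \<odot>\<^bsub>M\<^esub> (s \<odot>\<^bsub>M\<^esub> x)" by (auto simp: smult_assoc1)
    define y where "y = m' \<ominus>\<^bsub>M\<^esub> s \<odot>\<^bsub>M\<^esub> x"
    have y: "y \<in> ?K" using x m' smult_eq_iff_diff[of d m' "s \<odot>\<^bsub>M\<^esub> x"] by (simp add: y_def)
    have "s \<odot>\<^bsub>M\<^esub> x \<oplus>\<^bsub>M\<^esub> y = m'"
      using x m' by (simp add: y_def a_minus_def M.a_comm[of m'] M.r_neg flip: M.a_assoc)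
    then have "m = t \<odot>\<^bsub>M\<^esub> (s \<odot>\<^bsub>M\<^esub> x \<oplus>\<^bsub>M\<^esub> y)" using m' by simp
    also have "\<dots> = (s \<otimes> t) \<odot>\<^bsub>M\<^esub> x \<oplus>\<^bsub>M\<^esub> t \<odot>\<^bsub>M\<^esub> y"
      using x y by (simp add: smult_r_distr smult_assoc1 R.m_comm[of s t])
    finally show ?thesis using x y by blast
  qed
  \<comment> \<open>Applying \<open>step\<close> again to the remainder \<open>y\<close> raises the
    power of \<open>t\<close> by one and changes only the part in \<open>s t M\<close>.\<close>
  have iter: "\<exists>x\<in>carrier M. \<exists>y\<in>?K. m = (s \<otimes> t) \<odot>\<^bsub>M\<^esub> x \<oplus>\<^bsub>M\<^esub> (t [^] j) \<odot>\<^bsub>M\<^esub> y" for j :: nat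
  proof (induction j)
    case 0
    show ?case using m by (intro bexI[of _ "\<zero>\<^bsub>M\<^esub>"] bexI[of _ m]) auto
  next
    case (Suc j)
    then obtain x y where xy: "x \<in> carrier M" "y \<in> ?K"
      and meq: "m = (s \<otimes> t) \<odot>\<^bsub>M\<^esub> x \<oplus>\<^bsub>M\<^esub> (t [^] j) \<odot>\<^bsub>M\<^esub> y" by blast
    from step[OF xy(2)] obtain x' y' where xy': "x' \<in> carrier M" "y' \<in> ?K"
      and yeq: "y = (s \<otimes> t) \<odot>\<^bsub>M\<^esub> x' \<oplus>\<^bsub>M\<^esub> t \<odot>\<^bsub>M\<^esub> y'" by blast
    have "(t [^] j) \<odot>\<^bsub>M\<^esub> ((s \<otimes> t) \<odot>\<^bsub>M\<^esub> x') = (s \<otimes> t) \<odot>\<^bsub>M\<^esub> ((t [^] j) \<odot>\<^bsub>M\<^esub> x')"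
      using xy' R.m_comm[of "t [^] j" "s \<otimes> t"] by (simp flip: smult_assoc1)
    moreover have "(t [^] j) \<odot>\<^bsub>M\<^esub> (t \<odot>\<^bsub>M\<^esub> y') = (t [^] Suc j) \<odot>\<^bsub>M\<^esub> y'"
      using xy' by (simp flip: smult_assoc1)
    ultimately have "m = (s \<otimes> t) \<odot>\<^bsub>M\<^esub> (x \<oplus>\<^bsub>M\<^esub> (t [^] j) \<odot>\<^bsub>M\<^esub> x') \<oplus>\<^bsub>M\<^esub> (t [^] Suc j) \<odot>\<^bsub>M\<^esub> y'"
      using xy xy' unfolding meq yeq
      by (simp add: smult_r_distr M.a_assoc del: R.nat_pow_Suc)
    then show ?case using xy xy' by (intro bexI[of _ "x \<oplus>\<^bsub>M\<^esub> (t [^] j) \<odot>\<^bsub>M\<^esub> x'"] bexI[of _ y']) auto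
  qed
  \<comment> \<open>With exponent \<open>k + 1\<close> the remainder is
    \<open>t (t^k y) = t (s y)\<close>, which lies in \<open>s t M\<close> as well.\<close>
  from iter[of "Suc k"] obtain x y where xy: "x \<in> carrier M" "y \<in> ?K"
    and meq: "m = (s \<otimes> t) \<odot>\<^bsub>M\<^esub> x \<oplus>\<^bsub>M\<^esub> (t [^] Suc k) \<odot>\<^bsub>M\<^esub> y" by blast
  have "(t [^] Suc k) \<odot>\<^bsub>M\<^esub> y = t \<odot>\<^bsub>M\<^esub> ((t [^] k) \<odot>\<^bsub>M\<^esub> y)"
    using xy by (simp add: R.m_comm[of _ t] smult_assoc1)
  also have "\<dots> = (s \<otimes> t) \<odot>\<^bsub>M\<^esub> y"
    using xy by (simp add: R.m_comm[of _ t] smult_assoc1 flip: pow)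
  finally have "m = (s \<otimes> t) \<odot>\<^bsub>M\<^esub> (x \<oplus>\<^bsub>M\<^esub> y)"
    using xy meq by (simp add: smult_r_distr)
  then show ?thesis using xy by blast
qed

section \<open>Evaluating polynomials over a subring\<close>

text \<open>A ring homomorphism \<open>\<iota>\<close> from a subring \<open>Z\<close> to
  \<open>A\<close>, and an element \<open>\<gamma>\<close> to substitute for the variable.
  Polynomials keep the ambient coefficient type: over a field, identities may be proved there by
  cancellation and then carried to \<open>A\<close>, which may have zero divisors.\<close>

locale subring_eval = cring A for A (structure) +
  fixes Z :: "'c::comm_ring_1 set" and \<iota> :: "'c \<Rightarrow> 'a" and \<gamma> :: 'a
  assumes Z_0: "0 \<in> Z" and Z_1: "1 \<in> Z"
    and Z_add: "x \<in> Z \<Longrightarrow> y \<in> Z \<Longrightarrow> x + y \<in> Z" and Z_mult: "x \<in> Z \<Longrightarrow> y \<in> Z \<Longrightarrow> x * y \<in> Z"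
    and Z_uminus: "x \<in> Z \<Longrightarrow> - x \<in> Z"
    and \<iota>_closed [simp]: "x \<in> Z \<Longrightarrow> \<iota> x \<in> carrier A" and \<iota>_1 [simp]: "\<iota> 1 = \<one>"
    and \<iota>_add: "x \<in> Z \<Longrightarrow> y \<in> Z \<Longrightarrow> \<iota> (x + y) = \<iota> x \<oplus> \<iota> y"
    and \<iota>_mult: "x \<in> Z \<Longrightarrow> y \<in> Z \<Longrightarrow> \<iota> (x * y) = \<iota> x \<otimes> \<iota> y"
    and \<gamma>_closed [simp]: "\<gamma> \<in> carrier A"
begin

definition polys :: "'c poly set" where
  "polys = {P. \<forall>i. Polynomial.coeff P i \<in> Z}"

text \<open>Horner's scheme. The values are meaningful only on \<open>polys\<close>, since
  \<open>\<iota>\<close> is controlled only on \<open>Z\<close>.\<close>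

definition ev :: "'c poly \<Rightarrow> 'a" where
  "ev P = fold_coeffs (\<lambda>c r. \<iota> c \<oplus> \<gamma> \<otimes> r) P \<zero>"

lemma \<iota>_0 [simp]: "\<iota> 0 = \<zero>"
  using \<iota>_add[OF Z_0 Z_0] Z_0 by simp

lemma Z_power: "x \<in> Z \<Longrightarrow> x ^ k \<in> Z"
  by (induction k) (auto intro: Z_1 Z_mult)

lemma Z_sum: "(\<And>i. i \<in> I \<Longrightarrow> f i \<in> Z) \<Longrightarrow> sum f I \<in> Z"
  by (induction I rule: infinite_finite_induct) (auto intro: Z_0 Z_add)

lemma pCons_polys_iff: "pCons c P \<in> polys \<longleftrightarrow> c \<in> Z \<and> P \<in> polys"
  unfolding polys_def by (auto simp: coeff_pCons split: nat.splits)

lemma polys_0: "0 \<in> polys" and polys_1: "1 \<in> polys"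
  and polys_add: "P \<in> polys \<Longrightarrow> Q \<in> polys \<Longrightarrow> P + Q \<in> polys"
  and polys_uminus: "P \<in> polys \<Longrightarrow> - P \<in> polys"
  and polys_smult: "c \<in> Z \<Longrightarrow> P \<in> polys \<Longrightarrow> Polynomial.smult c P \<in> polys"
  and polys_monom: "c \<in> Z \<Longrightarrow> Polynomial.monom c i \<in> polys"
  by (auto simp: polys_def coeff_1 intro: Z_0 Z_1 Z_add Z_uminus Z_mult)

lemma polys_mult: "P \<in> polys \<Longrightarrow> Q \<in> polys \<Longrightarrow> P * Q \<in> polys"
  by (auto simp: polys_def Polynomial.coeff_mult intro!: Z_sum Z_mult)

lemma polys_prod: "(\<And>i. i \<in> I \<Longrightarrow> f i \<in> polys) \<Longrightarrow> prod f I \<in> polys"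
  by (induction I rule: infinite_finite_induct) (auto intro: polys_1 polys_mult)

lemma polys_sum: "(\<And>i. i \<in> I \<Longrightarrow> f i \<in> polys) \<Longrightarrow> sum f I \<in> polys"
  by (induction I rule: infinite_finite_induct) (auto intro: polys_0 polys_add)

lemmas polys_intros = Z_0 Z_1 Z_add Z_mult Z_uminus Z_power polys_0 polys_1 polys_add polys_uminus
  polys_smult polys_monom polys_mult polys_prod polys_sum pCons_polys_iff[THEN iffD2]

lemma ev_0 [simp]: "ev 0 = \<zero>"
  by (simp add: ev_def)

lemma ev_pCons: "ev (pCons c P) = \<iota> c \<oplus> \<gamma> \<otimes> ev P"
  by (cases "c = 0 \<and> P = 0") (auto simp: ev_def)

lemma ev_closed [simp]: "P \<in> polys \<Longrightarrow> ev P \<in> carrier A"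
  by (induction P) (auto simp: ev_pCons pCons_polys_iff)

lemma ev_1: "ev 1 = \<one>"
  by (simp add: one_pCons ev_pCons)

lemma ev_add: "P \<in> polys \<Longrightarrow> Q \<in> polys \<Longrightarrow> ev (P + Q) = ev P \<oplus> ev Q"
  by (induction P Q rule: poly_induct2)
    (auto simp: ev_pCons pCons_polys_iff \<iota>_add r_distr a_ac)

lemma ev_uminus: "P \<in> polys \<Longrightarrow> ev (- P) = \<ominus> ev P"
  using ev_add[of "- P" P] by (simp add: polys_uminus minus_equality)

lemma ev_diff: "P \<in> polys \<Longrightarrow> Q \<in> polys \<Longrightarrow> ev (P - Q) = ev P \<ominus> ev Q"
  using ev_add[of P "- Q"] by (simp add: polys_uminus ev_uminus a_minus_def)

lemma ev_smult: "c \<in> Z \<Longrightarrow> P \<in> polys \<Longrightarrow> ev (Polynomial.smult c P) = \<iota> c \<otimes> ev P"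
  by (induction P) (auto simp: ev_pCons pCons_polys_iff \<iota>_mult r_distr m_ac)

lemma ev_mult: "P \<in> polys \<Longrightarrow> Q \<in> polys \<Longrightarrow> ev (P * Q) = ev P \<otimes> ev Q"
proof (induction P)
  case (pCons c P)
  then have "c \<in> Z" "P \<in> polys" by (auto simp: pCons_polys_iff)
  with pCons show ?case
    by (simp add: ev_add ev_smult polys_intros ev_pCons l_distr m_assoc)
qed simp

lemma ev_monom: "c \<in> Z \<Longrightarrow> ev (Polynomial.monom c i) = \<iota> c \<otimes> \<gamma> [^] i"
  by (induction i) (auto simp: monom_0 monom_Suc ev_pCons m_ac)

lemma ev_sum:
  "finite I \<Longrightarrow> (\<And>i. i \<in> I \<Longrightarrow> f i \<in> polys) \<Longrightarrow> ev (sum f I) = (\<Oplus>i\<in>I. ev (f i))"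
proof (induction I rule: finite_induct)
  case (insert i I)
  then have "(\<Oplus>j\<in>insert i I. ev (f j)) = ev (f i) \<oplus> (\<Oplus>j\<in>I. ev (f j))"
    by (intro finsum_insert) auto
  then show ?case using insert by (simp add: ev_add polys_sum)
qed simp

end

locale subring_eval_module = subring_eval A Z \<iota> \<gamma> + module A M
  for A (structure) and Z and \<iota> and \<gamma> and M (structure)
begin

lemma linear_smult_eq_zero_iff:
  assumes "u \<in> Z" "m \<in> carrier M"
  shows "ev [:- u, 1:] \<odot>\<^bsub>M\<^esub> m = \<zero>\<^bsub>M\<^esub> \<longleftrightarrow> \<gamma> \<odot>\<^bsub>M\<^esub> m = \<iota> u \<odot>\<^bsub>M\<^esub> m"
proof -
  have "[:- u, 1:] = Polynomial.monom 1 1 - Polynomial.monom u 0"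
    by (simp add: monom_0 monom_Suc)
  then have "ev [:- u, 1:] = \<gamma> \<ominus> \<iota> u"
    using assms by (simp add: ev_diff ev_monom polys_monom Z_1)
  then show ?thesis
    using assms by (simp add: a_minus_def smult_l_distr smult_l_minus M.add.inv_solve_right')
qed

text \<open>Induction along Horner's scheme. Membership of \<open>poly P u\<close> in
  \<open>Z\<close> is carried along because \<open>\<iota>\<close> is additive and multiplicative
  only there.\<close>

lemma ev_smult_eigenvector:
  assumes u: "u \<in> Z" and m: "m \<in> carrier M" and eig: "\<gamma> \<odot>\<^bsub>M\<^esub> m = \<iota> u \<odot>\<^bsub>M\<^esub> m" and P: "P \<in> polys"
  shows "poly P u \<in> Z \<and> ev P \<odot>\<^bsub>M\<^esub> m = \<iota> (poly P u) \<odot>\<^bsub>M\<^esub> m"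
  using P
proof (induction P)
  case (pCons c P)
  then have c: "c \<in> Z" and P: "P \<in> polys" and IH: "poly P u \<in> Z"
    "ev P \<odot>\<^bsub>M\<^esub> m = \<iota> (poly P u) \<odot>\<^bsub>M\<^esub> m" by (auto simp: pCons_polys_iff)
  have "(\<gamma> \<otimes> ev P) \<odot>\<^bsub>M\<^esub> m = ev P \<odot>\<^bsub>M\<^esub> (\<iota> u \<odot>\<^bsub>M\<^esub> m)"
    using P m u by (simp add: m_comm[of \<gamma>] smult_assoc1 eig)
  also have "\<dots> = \<iota> u \<odot>\<^bsub>M\<^esub> (\<iota> (poly P u) \<odot>\<^bsub>M\<^esub> m)"
    using P m u IH by (simp flip: smult_assoc1 IH(2) add: m_comm[of "ev P"])
  finally show ?case
    using c P IH m u by (simp add: ev_pCons smult_l_distr \<iota>_add \<iota>_mult Z_add Z_mult smult_assoc1)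
qed (use m Z_0 in simp)

end

section \<open>Modules over a ring containing an element of finite order\<close>

text \<open>With \<open>y = X / u\<close> the linear factor is \<open>u (y - 1)\<close>, and the sum
  is the geometric sum in \<open>y\<close>.\<close>

lemma linear_mult_geometric_sum:
  fixes u :: "'c::field"
  assumes "u \<noteq> 0"
  shows "[:- u, 1:] * (\<Sum>i<N. Polynomial.monom (inverse u ^ i) i) =
    Polynomial.smult u (Polynomial.monom (inverse u ^ N) N - 1)"
proof -
  let ?y = "Polynomial.monom (inverse u) 1"
  have y: "?y ^ i = Polynomial.monom (inverse u ^ i) i" for i
    by (simp add: monom_power)
  have "[:- u, 1:] = Polynomial.smult u (?y - 1)"
    using assms by (simp add: monom_0 monom_Suc one_pCons)
  moreover have "(?y - 1) * (\<Sum>i<N. Polynomial.monom (inverse u ^ i) i) = Polynomial.monom (inverse u ^ N) N - 1"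
    using power_diff_1_eq[of ?y N] by (simp only: y)
  ultimately show ?thesis by (simp only: mult_smult_left)
qed

text \<open>The polynomial form of \<open>\<epsilon>\<^sub>\<psi> = s t\<close>. Multiplied by
  \<open>X - u\<close>, both sides become \<open>u ((X / u)^(N p) - 1)\<close>, and the nonzero
  factor cancels in the polynomial ring over a field.\<close>

lemma geometric_sum_mult:
  fixes u :: "'c::field"
  assumes "u \<noteq> 0"
  shows "(\<Sum>i<N. Polynomial.monom (inverse u ^ i) i) * (\<Sum>i<p. Polynomial.monom (inverse u ^ (N * i)) (N * i)) =
    (\<Sum>i<N * p. Polynomial.monom (inverse u ^ i) i)"
proof -
  let ?S = "\<lambda>N. \<Sum>i<N. Polynomial.monom (inverse u ^ i) i"
  let ?w = "Polynomial.monom (inverse u ^ N) N"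
  have w: "?w ^ i = Polynomial.monom (inverse u ^ (N * i)) (N * i)" for i
    by (simp add: monom_power power_mult)
  have "[:- u, 1:] * (?S N * (\<Sum>i<p. Polynomial.monom (inverse u ^ (N * i)) (N * i))) =
      ([:- u, 1:] * ?S N) * (\<Sum>i<p. ?w ^ i)" by (simp only: w mult.assoc)
  also have "\<dots> = Polynomial.smult u (?w ^ p - 1)"
    using assms by (simp only: linear_mult_geometric_sum[OF assms] mult_smult_left power_diff_1_eq[symmetric])
  also have "\<dots> = [:- u, 1:] * ?S (N * p)"
    using assms by (simp only: linear_mult_geometric_sum[OF assms] w)
  finally show ?thesis by (rule mult_left_cancel[THEN iffD1, rotated]) simp
qed

text \<open>Both sides have degree at most \<open>q\<close> with equal coefficient at
  \<open>q\<close>, and they vanish at the \<open>q\<close> distinct powers of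
  \<open>\<zeta>\<close>.\<close>

lemma prod_linear_powers_of_root:
  fixes \<zeta> :: "'c::field"
  assumes q: "q > 0" and \<zeta>: "\<zeta> ^ q = 1" and inj: "inj_on (\<lambda>k. \<zeta> ^ k) {..<q}"
  shows "(\<Prod>k<q. [:- (\<zeta> ^ k), 1:]) = Polynomial.monom 1 q - 1"
proof (rule poly_eqI_degree_lead_coeff)
  let ?P = "\<Prod>k<q. [:- (\<zeta> ^ k), 1:]"
  have deg: "Polynomial.degree ?P = q" by (subst degree_prod_eq_sum_degree) auto
  have "Polynomial.lead_coeff ?P = 1" by (simp only: lead_coeff_prod) simp
  then show "Polynomial.coeff ?P q = Polynomial.coeff (Polynomial.monom 1 q - 1) q"
    using q deg by (simp add: coeff_1)
  show "Polynomial.degree ?P \<le> q" using deg by simp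
  show "Polynomial.degree (Polynomial.monom 1 q - 1 :: 'c poly) \<le> q"
    by (intro degree_diff_le) (auto simp: degree_monom_le)
  show "q \<le> card ((\<lambda>k. \<zeta> ^ k) ` {..<q})" by (simp add: card_image[OF inj])
  fix z assume "z \<in> (\<lambda>k. \<zeta> ^ k) ` {..<q}"
  then obtain k where k: "k < q" "z = \<zeta> ^ k" by auto
  then have "z ^ q = 1" by (metis \<zeta> mult.commute power_mult power_one)
  then show "poly ?P z = poly (Polynomial.monom 1 q - 1) z"
    using k by (auto simp: poly_prod poly_monom intro!: prod_zero)
qed

lemma (in subring_eval) ev_monom_diff_1:
  "\<gamma> [^] q = \<one> \<Longrightarrow> ev (Polynomial.monom 1 q - 1) = \<zero>"
  by (simp add: ev_diff polys_intros ev_monom ev_1 a_minus_def r_neg)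

lemma (in subring_eval) ev_power: "P \<in> polys \<Longrightarrow> P ^ k \<in> polys \<and> ev (P ^ k) = ev P [^] k"
  by (induction k) (auto simp: ev_1 polys_1 ev_mult polys_mult m_comm)

lemma (in subring_eval) linear_polys: "u \<in> Z \<Longrightarrow> [:- u, 1:] \<in> polys"
  by (auto simp: pCons_polys_iff intro: polys_intros)

section \<open>Eigenvectors of an element of finite order\<close>

text \<open>Together \<open>\<zeta>_pow\<close> and \<open>\<zeta>_inj\<close> say that
  \<open>\<zeta>\<close> is a primitive \<open>q\<close>-th root of unity; no such independence is
  assumed for its image in \<open>A\<close>.\<close>

locale root_eval_module = subring_eval_module A Z \<iota> \<gamma> M
  for A (structure) and Z :: "'c::field set" and \<iota> and \<gamma> and M (structure) +
  fixes q :: nat and \<zeta> :: 'c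
  assumes q_pos: "q > 0" and \<zeta>_Z: "\<zeta> \<in> Z" and \<zeta>_pow: "\<zeta> ^ q = 1"
    and \<zeta>_inj: "inj_on (\<lambda>k. \<zeta> ^ k) {..<q}"
    and \<gamma>_pow: "\<gamma> [^] q = \<one>" and finite_M: "finite (carrier M)"
begin

definition eigvecs :: "'c \<Rightarrow> 'd set" where
  "eigvecs u = {m \<in> carrier M. \<gamma> \<odot>\<^bsub>M\<^esub> m = \<iota> u \<odot>\<^bsub>M\<^esub> m}"

text \<open>For \<open>\<gamma> = g\<close> and \<open>u = \<psi>(g)\<close>, the value of this
  polynomial at \<open>\<gamma>\<close> is \<open>\<epsilon>\<^sub>\<psi>\<close> when
  \<open>N = q\<close>, and the element \<open>s\<close> when \<open>N = p^(n-1)\<close>.\<close>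

definition geom_poly :: "'c \<Rightarrow> nat \<Rightarrow> 'c poly" where
  "geom_poly u N = (\<Sum>i<N. Polynomial.monom (inverse u ^ i) i)"

text \<open>\<open>Z\<close> is only a subring, but the inverse of a root of unity is its power
  \<open>u^(q-1)\<close>.\<close>

lemma inverse_Z:
  assumes "u \<in> Z" "u ^ q = 1"
  shows "u \<noteq> 0" "inverse u \<in> Z"
proof -
  have "u * u ^ (q - 1) = 1" using assms q_pos by (simp flip: power_Suc)
  then have "inverse u = u ^ (q - 1)" by (rule inverse_unique)
  then show "inverse u \<in> Z" using assms by (simp add: Z_power)
  show "u \<noteq> 0" using assms q_pos by (auto simp: zero_power)
qed

lemma eigvecs_iff:
  "u \<in> Z \<Longrightarrow> eigvecs u = {m \<in> carrier M. ev [:- u, 1:] \<odot>\<^bsub>M\<^esub> m = \<zero>\<^bsub>M\<^esub>}"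
  by (auto simp: eigvecs_def linear_smult_eq_zero_iff)

text \<open>The filtration count with \<open>a k = \<gamma> - \<zeta>^k\<close> and
  \<open>b k\<close> the product of the earlier linear factors;
  \<open>b q = \<gamma>^q - 1 = 0\<close>.\<close>

lemma card_eq_prod_eigvecs:
  assumes "\<And>k. k < q \<Longrightarrow> eigvecs (\<zeta> ^ k) \<subseteq> (\<lambda>m. ev (geom_poly (\<zeta> ^ k) q) \<odot>\<^bsub>M\<^esub> m) ` carrier M"
  shows "card (carrier M) = (\<Prod>k<q. card (eigvecs (\<zeta> ^ k)))"
proof -
  let ?D = "\<lambda>k. [:- (\<zeta> ^ k), 1:]"
  let ?b = "\<lambda>k. \<Prod>j<k. ?D j"
  have D [simp]: "?D k \<in> polys" for k by (intro linear_polys Z_power \<zeta>_Z)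
  have b [simp]: "?b k \<in> polys" for k by (intro polys_prod D)
  have "card (carrier M) = (\<Prod>k<q. card {m \<in> carrier M. ev (?D k) \<odot>\<^bsub>M\<^esub> m = \<zero>\<^bsub>M\<^esub>})"
  proof (rule card_eq_prod_kernels[where b = "\<lambda>k. ev (?b k)"])
    show "ev (?b (Suc k)) = ev (?D k) \<otimes> ev (?b k)" for k
      by (simp only: lessThan_Suc prod.insert[OF finite_lessThan] lessThan_iff less_irrefl if_False
          not_False_eq_True ev_mult D b)
    show "ev (?b q) = \<zero>"
      using prod_linear_powers_of_root[OF q_pos \<zeta>_pow \<zeta>_inj] ev_monom_diff_1[OF \<gamma>_pow] by simp
    fix k m
    assume k: "k < q" and m: "m \<in> carrier M" and "ev (?D k) \<odot>\<^bsub>M\<^esub> m = \<zero>\<^bsub>M\<^esub>"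
    then have "m \<in> eigvecs (\<zeta> ^ k)" by (simp add: eigvecs_iff Z_power \<zeta>_Z)
    with assms[OF k] obtain x where x: "x \<in> carrier M" "m = ev (geom_poly (\<zeta> ^ k) q) \<odot>\<^bsub>M\<^esub> x" by auto
    \<comment> \<open>\<open>?Q\<close> collects the factors after the \<open>k\<close>-th and the
      unit \<open>\<zeta>^k\<close>. Both \<open>geom_poly (\<zeta> ^ k) q\<close> and
      \<open>?b k * ?Q\<close> give \<open>\<zeta>^k (X^q - 1)\<close> when multiplied by
      \<open>X - \<zeta>^k\<close>, so they agree, and an image under the former lies in the image
      of \<open>?b k\<close>.\<close>
    let ?Q = "Polynomial.smult (\<zeta> ^ k) (\<Prod>j\<in>{k<..<q}. ?D j)"
    have Q [simp]: "?Q \<in> polys" by (intro polys_smult polys_prod D Z_power \<zeta>_Z)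
    have 0: "\<zeta> ^ k \<noteq> 0" using \<zeta>_pow q_pos by (auto simp: zero_power)
    have "(\<zeta> ^ k) ^ q = 1" by (metis \<zeta>_pow mult.commute power_mult power_one)
    then have "?D k * geom_poly (\<zeta> ^ k) q = Polynomial.smult (\<zeta> ^ k) (Polynomial.monom 1 q - 1)"
      using linear_mult_geometric_sum[OF 0, of q] by (simp only: geom_poly_def power_inverse inverse_1)
    also have "Polynomial.monom 1 q - 1 = prod ?D {..<q}"
      by (simp only: prod_linear_powers_of_root[OF q_pos \<zeta>_pow \<zeta>_inj])
    also have "{..<q} = insert k ({..<k} \<union> {k<..<q})" using k by auto
    also have "prod ?D \<dots> = ?D k * prod ?D ({..<k} \<union> {k<..<q})" by (rule prod.insert) auto
    also have "prod ?D ({..<k} \<union> {k<..<q}) = ?b k * prod ?D {k<..<q}"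
      by (rule prod.union_disjoint) auto
    finally have "?D k * geom_poly (\<zeta> ^ k) q = ?D k * (?b k * ?Q)"
      by (simp only: mult_smult_right)
    then have "geom_poly (\<zeta> ^ k) q = ?b k * ?Q"
      by (rule mult_left_cancel[THEN iffD1, rotated]) simp
    then have "m = ev (?b k) \<odot>\<^bsub>M\<^esub> (ev ?Q \<odot>\<^bsub>M\<^esub> x)"
      using x by (simp only: ev_mult b Q smult_assoc1 ev_closed)
    then show "m \<in> (\<lambda>m. ev (?b k) \<odot>\<^bsub>M\<^esub> m) ` carrier M"
      using x by (simp only: image_eqI smult_closed ev_closed Q)
  qed (simp_all add: finite_M ev_1)
  then show ?thesis by (simp only: eigvecs_iff Z_power \<zeta>_Z)
qed

text \<open>For \<open>\<gamma> = g\<close> and \<open>u = \<psi>(g)\<close>, the assumption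
  \<open>hyp\<close> is the vanishing condition for the restriction of \<open>\<psi>\<close> to the
  subgroup generated by \<open>g^(p^r)\<close>. The claim is \<open>kernel_subset_image_mult\<close>
  for the values of \<open>?D\<close>, \<open>?S\<close>, \<open>?T\<close>.\<close>

lemma eigvecs_subset_image:
  assumes qNp: "q = p ^ r * p" and u: "u \<in> Z" "u ^ q = 1"
    and hyp: "\<And>m. m \<in> carrier M \<Longrightarrow> \<gamma> [^] (p ^ r) \<odot>\<^bsub>M\<^esub> m = \<iota> (u ^ (p ^ r)) \<odot>\<^bsub>M\<^esub> m \<Longrightarrow>
      m \<in> (\<lambda>m. ev (\<Sum>i<p. Polynomial.monom (inverse u ^ (p ^ r * i)) (p ^ r * i)) \<odot>\<^bsub>M\<^esub> m) ` carrier M"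
  shows "eigvecs u \<subseteq> (\<lambda>m. ev (geom_poly u q) \<odot>\<^bsub>M\<^esub> m) ` carrier M"
proof
  let ?N = "p ^ r"
  let ?D = "[:- u, 1:]"
  let ?S = "geom_poly u ?N"
  let ?T = "\<Sum>i<p. Polynomial.monom (inverse u ^ (?N * i)) (?N * i)"
  note u0 = inverse_Z[OF u]
  have D [simp]: "?D \<in> polys" by (rule linear_polys[OF u(1)])
  have S [simp]: "?S \<in> polys" unfolding geom_poly_def by (intro polys_intros u0)
  have T [simp]: "?T \<in> polys" by (intro polys_intros u0)
  have ST: "?S * ?T = geom_poly u q"
    using geometric_sum_mult[OF u0(1)] by (simp only: geom_poly_def qNp)
  have DE: "?D * geom_poly u q = Polynomial.smult u (Polynomial.monom 1 q - 1)"
    using linear_mult_geometric_sum[OF u0(1), of q] u by (simp only: geom_poly_def power_inverse inverse_1)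
  \<comment> \<open>Scaling by \<open>u^N\<close> clears the denominators:
    \<open>u^N (X - u) S = u (X^N - u^N)\<close>. Thus whatever \<open>d s\<close> kills is killed
    by \<open>u (\<gamma>^N - u^N)\<close>.\<close>
  have "Polynomial.smult (u ^ ?N) (?D * ?S) =
      Polynomial.smult u (Polynomial.monom 1 ?N - Polynomial.monom (u ^ ?N) 0)"
    using u0(1) linear_mult_geometric_sum[OF u0(1), of ?N]
    by (simp add: geom_poly_def smult_diff_right smult_monom power_inverse monom_0 one_pCons
        mult.commute del: mult_pCons_left)
  then have "\<iota> (u ^ ?N) \<otimes> ev (?D * ?S) = ev (Polynomial.smult u (Polynomial.monom 1 ?N - Polynomial.monom (u ^ ?N) 0))"
    by (metis D S Z_power ev_smult polys_mult u(1))
  also have "\<dots> = \<iota> u \<otimes> (\<gamma> [^] ?N \<ominus> \<iota> (u ^ ?N))"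
    using u Z_1 Z_power[OF u(1), of ?N] polys_monom[of 1 ?N] polys_monom[of "u ^ ?N" 0]
      polys_add[of "Polynomial.monom 1 ?N" "- Polynomial.monom (u ^ ?N) 0"]
      polys_uminus[of "Polynomial.monom (u ^ ?N) 0"]
    by (simp add: ev_smult ev_diff ev_monom)
  finally have DS: "\<iota> (u ^ ?N) \<otimes> ev (?D * ?S) = \<iota> u \<otimes> (\<gamma> [^] ?N \<ominus> \<iota> (u ^ ?N))" .
  fix m assume "m \<in> eigvecs u"
  then have m: "m \<in> carrier M" "ev ?D \<odot>\<^bsub>M\<^esub> m = \<zero>\<^bsub>M\<^esub>"
    using u by (auto simp: eigvecs_iff)
  have "m \<in> (\<lambda>m. (ev ?S \<otimes> ev ?T) \<odot>\<^bsub>M\<^esub> m) ` carrier M"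
  proof (rule kernel_subset_image_mult[OF finite_M, where d = "ev ?D" and k = r])
    have "ev ?T \<otimes> (ev ?D \<otimes> ev ?S) = ev (?D * (?S * ?T))"
      by (simp add: ev_mult polys_mult m_comm[of "ev ?T"] m_assoc del: mult_pCons_left)
    also have "\<dots> = ev (Polynomial.smult u (Polynomial.monom 1 q - 1))" by (simp only: ST DE)
    also have "\<dots> = \<zero>"
      using u polys_add[of "Polynomial.monom 1 q" "- 1"]
      by (simp add: ev_smult polys_intros ev_monom_diff_1[OF \<gamma>_pow])
    finally show "ev ?T \<otimes> (ev ?D \<otimes> ev ?S) = \<zero>" .
  next
    fix m assume m: "m \<in> carrier M" and 0: "(ev ?D \<otimes> ev ?S) \<odot>\<^bsub>M\<^esub> m = \<zero>\<^bsub>M\<^esub>"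
    have "(\<iota> (u ^ ?N) \<otimes> ev (?D * ?S)) \<odot>\<^bsub>M\<^esub> m = \<zero>\<^bsub>M\<^esub>"
      using m 0 u by (simp add: ev_mult Z_power smult_assoc1 del: mult_pCons_left)
    then have *: "\<iota> u \<odot>\<^bsub>M\<^esub> ((\<gamma> [^] ?N \<ominus> \<iota> (u ^ ?N)) \<odot>\<^bsub>M\<^esub> m) = \<zero>\<^bsub>M\<^esub>"
      using m u by (simp add: DS smult_assoc1 Z_power del: mult_pCons_left)
    \<comment> \<open>The factor \<open>\<iota> u\<close> is removed with its inverse
      \<open>\<iota> (inverse u)\<close>.\<close>
    have "(\<gamma> [^] ?N \<ominus> \<iota> (u ^ ?N)) \<odot>\<^bsub>M\<^esub> m =
        (\<iota> (inverse u) \<otimes> \<iota> u) \<odot>\<^bsub>M\<^esub> ((\<gamma> [^] ?N \<ominus> \<iota> (u ^ ?N)) \<odot>\<^bsub>M\<^esub> m)"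
      using m u u0 by (simp add: Z_power flip: \<iota>_mult)
    also have "\<dots> = \<zero>\<^bsub>M\<^esub>" using m u u0 * by (subst smult_assoc1) (simp_all add: Z_power)
    finally have "\<gamma> [^] ?N \<odot>\<^bsub>M\<^esub> m = \<iota> (u ^ ?N) \<odot>\<^bsub>M\<^esub> m"
      using m u by (simp add: a_minus_def smult_l_distr smult_l_minus Z_power M.add.inv_solve_right')
    with m show "m \<in> (\<lambda>m. ev ?T \<odot>\<^bsub>M\<^esub> m) ` carrier M" by (rule hyp)
  next
    fix m assume m: "m \<in> carrier M" and 0: "ev ?D \<odot>\<^bsub>M\<^esub> m = \<zero>\<^bsub>M\<^esub>"
    then have eig: "\<gamma> \<odot>\<^bsub>M\<^esub> m = \<iota> u \<odot>\<^bsub>M\<^esub> m" using linear_smult_eq_zero_iff[OF u(1) m] by simp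
    \<comment> \<open>At \<open>X = u\<close> every summand is 1, so \<open>?T\<close> has value
      \<open>p\<close> and \<open>?S\<close> has value \<open>p^r\<close>; hence \<open>s\<close>
      acts as \<open>t^r\<close> on eigenvectors. This is where \<open>N\<close> has to be a power
      of \<open>p\<close>.\<close>
    have "poly (?T ^ r) u = poly ?S u"
      using u0(1) by (simp add: geom_poly_def poly_sum poly_monom poly_power power_inverse)
    then have "ev ?S \<odot>\<^bsub>M\<^esub> m = ev (?T ^ r) \<odot>\<^bsub>M\<^esub> m"
      using ev_smult_eigenvector[OF u(1) m eig S] ev_smult_eigenvector[OF u(1) m eig, of "?T ^ r"]
        ev_power[OF T, of r] by simp
    then show "ev ?S \<odot>\<^bsub>M\<^esub> m = ev ?T [^] r \<odot>\<^bsub>M\<^esub> m" using ev_power[OF T, of r] by simp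
  qed (simp_all add: m)
  then show "m \<in> (\<lambda>m. ev (geom_poly u q) \<odot>\<^bsub>M\<^esub> m) ` carrier M"
    by (simp add: ev_mult flip: ST)
qed

end

section \<open>Group rings, characters and quotients\<close>

lemma (in cring) gr_monom_closed [simp]:
  "r \<in> carrier R \<Longrightarrow> gr_monom R G r x \<in> carrier (group_ring R G)"
  by (auto simp: gr_monom_def group_ring_simps)

lemma (in cring) gr_monom_add:
  "r \<in> carrier R \<Longrightarrow> s \<in> carrier R \<Longrightarrow>
    gr_monom R G (r \<oplus> s) x = gr_monom R G r x \<oplus>\<^bsub>group_ring R G\<^esub> gr_monom R G s x"
  by (auto simp: gr_monom_def group_ring_simps intro!: restrict_ext)

lemma (in cring) gr_monom_one: "gr_monom R G \<one> \<one>\<^bsub>G\<^esub> = \<one>\<^bsub>group_ring R G\<^esub>"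
  by (simp add: gr_monom_def group_ring_simps)

lemma (in cring) gr_monom_mult:
  assumes G: "group G" "finite (carrier G)" and rs [simp]: "r \<in> carrier R" "s \<in> carrier R"
    and st: "x \<in> carrier G" "y \<in> carrier G"
  shows "gr_monom R G r x \<otimes>\<^bsub>group_ring R G\<^esub> gr_monom R G s y = gr_monom R G (r \<otimes> s) (x \<otimes>\<^bsub>G\<^esub> y)"
proof -
  interpret G: group G by fact
  have "(\<Oplus>w\<in>carrier G. gr_monom R G r x w \<otimes> gr_monom R G s y (inv\<^bsub>G\<^esub> w \<otimes>\<^bsub>G\<^esub> z)) =
      (if z = x \<otimes>\<^bsub>G\<^esub> y then r \<otimes> s else \<zero>)" if z: "z \<in> carrier G" for z
  proof -
    have eq: "inv\<^bsub>G\<^esub> x \<otimes>\<^bsub>G\<^esub> z = y \<longleftrightarrow> z = x \<otimes>\<^bsub>G\<^esub> y"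
      using st z by (metis G.inv_solve_left)
    have "(\<Oplus>w\<in>carrier G. gr_monom R G r x w \<otimes> gr_monom R G s y (inv\<^bsub>G\<^esub> w \<otimes>\<^bsub>G\<^esub> z)) =
        (\<Oplus>w\<in>carrier G. if x = w then r \<otimes> (if z = x \<otimes>\<^bsub>G\<^esub> y then s else \<zero>) else \<zero>)"
      using st z eq by (intro finsum_cong') (auto simp: gr_monom_def)
    also have "\<dots> = r \<otimes> (if z = x \<otimes>\<^bsub>G\<^esub> y then s else \<zero>)"
      using finsum_singleton[OF st(1) G(2), of "\<lambda>_. r \<otimes> (if z = x \<otimes>\<^bsub>G\<^esub> y then s else \<zero>)"] by auto
    finally show ?thesis by simp
  qed
  then show ?thesis by (auto simp: group_ring_simps gr_monom_def[of R G "r \<otimes> s"] intro!: restrict_ext)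
qed

lemma (in cring) gr_monom_pow:
  assumes G: "group G" "finite (carrier G)" and g: "g \<in> carrier G"
  shows "gr_monom R G \<one> g [^]\<^bsub>group_ring R G\<^esub> (i::nat) = gr_monom R G \<one> (g [^]\<^bsub>G\<^esub> i)"
proof (induction i)
  case 0
  then show ?case by (simp add: gr_monom_one)
next
  case (Suc i)
  then show ?case
    using assms by (simp add: gr_monom_mult group.is_monoid monoid.nat_pow_closed)
qed

lemma (in cring) finsum_gr_monom:
  assumes G: "group G" "finite (carrier G)" and "B \<subseteq> carrier G" and f: "\<And>x. x \<in> B \<Longrightarrow> f x \<in> carrier R"
  shows "(\<Oplus>\<^bsub>group_ring R G\<^esub>x\<in>B. gr_monom R G (f x) x) = (\<lambda>x\<in>carrier G. if x \<in> B then f x else \<zero>)"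
proof -
  interpret RG: ring "group_ring R G" by (rule ring_group_ring) (use G is_cring in auto)
  have "finite B" using assms by (auto intro: finite_subset)
  then show ?thesis using assms(3) f
  proof (induction B rule: finite_induct)
    case (insert a A)
    have "(\<Oplus>\<^bsub>group_ring R G\<^esub>x\<in>insert a A. gr_monom R G (f x) x) =
        gr_monom R G (f a) a \<oplus>\<^bsub>group_ring R G\<^esub> (\<Oplus>\<^bsub>group_ring R G\<^esub>x\<in>A. gr_monom R G (f x) x)"
      using insert by (intro RG.finsum_insert) auto
    also have "(\<Oplus>\<^bsub>group_ring R G\<^esub>x\<in>A. gr_monom R G (f x) x) =
        (\<lambda>x\<in>carrier G. if x \<in> A then f x else \<zero>)"
      using insert by auto
    finally show ?case
      using insert by (auto simp: group_ring_simps gr_monom_def intro!: restrict_ext)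
  qed (simp add: group_ring_simps)
qed

lemma gr_incl_monom:
  assumes "H \<subseteq> carrier G"
  shows "gr_incl R G H (gr_monom R (G\<lparr>carrier := H\<rparr>) r \<sigma>) = (if \<sigma> \<in> H then gr_monom R G r \<sigma> else \<zero>\<^bsub>group_ring R G\<^esub>)"
  using assms by (auto simp: gr_incl_def gr_monom_def group_ring_simps intro!: restrict_ext)

text \<open>The value at the identity is idempotent and a \<open>q\<close>-th root of unity, hence
  1; multiplicativity does the rest.\<close>

lemma character_power:
  assumes "group G" "q > 0" "\<psi> \<in> hom G (root_group q)" "g \<in> carrier G"
  shows "\<psi> (g [^]\<^bsub>G\<^esub> (i::nat)) = \<psi> g ^ i"
proof -
  interpret group G by fact
  have "\<psi> \<one>\<^bsub>G\<^esub> * \<psi> \<one>\<^bsub>G\<^esub> = \<psi> \<one>\<^bsub>G\<^esub>" "\<psi> \<one>\<^bsub>G\<^esub> ^ q = 1"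
    using assms(3) hom_mult[OF assms(3) one_closed one_closed] hom_in_carrier[OF assms(3) one_closed]
    by (auto simp: root_group_def)
  then have "\<psi> \<one>\<^bsub>G\<^esub> = 1" using assms(2) by (auto simp: zero_power)
  then show ?thesis
    using assms(4) hom_mult[OF assms(3)] by (induction i) (auto simp: root_group_def)
qed

section \<open>Trivial quotients of abelian groups\<close>

text \<open>A trivial quotient has \<open>I\<close> as its only coset, and the coset of
  \<open>x\<close> contains \<open>\<zero> \<oplus> x = x\<close>.\<close>

lemma (in abelian_group) A_Mod_trivialD:
  assumes "trivial_group (G\<lparr>carrier := E\<rparr> A_Mod I)" "E \<subseteq> carrier G" "\<zero> \<in> I"
  shows "E \<subseteq> I"
proof
  fix x assume x: "x \<in> E"
  have "I +>\<^bsub>G\<lparr>carrier := E\<rparr>\<^esub> x \<in> carrier (G\<lparr>carrier := E\<rparr> A_Mod I)"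
    using x by (auto simp: A_FactGroup_def' A_RCOSETS_def')
  then have "I +>\<^bsub>G\<lparr>carrier := E\<rparr>\<^esub> x = I"
    using assms(1) by (auto simp: trivial_group_def A_FactGroup_def')
  moreover have "\<zero> \<oplus> x \<in> I +>\<^bsub>G\<lparr>carrier := E\<rparr>\<^esub> x"
    using assms(3) by (auto simp: a_r_coset_def')
  ultimately show "x \<in> I" using x assms(2) by auto
qed

lemma (in abelian_group) A_Mod_self_trivial:
  assumes "subgroup E (add_monoid G)"
  shows "trivial_group (G\<lparr>carrier := E\<rparr> A_Mod E)"
proof -
  let ?K = "add_monoid (G\<lparr>carrier := E\<rparr>)"
  have K: "?K = (add_monoid G)\<lparr>carrier := E\<rparr>" by simp
  interpret K: group ?K unfolding K by (rule a_group[THEN group.subgroup_imp_group, OF assms])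
  have sub: "subgroup E ?K" using K.subgroup_self by simp
  have comm: "x \<oplus> y = y \<oplus> x" if "x \<in> E" "y \<in> E" for x y
    using that subgroup.mem_carrier[OF assms] by (simp add: a_comm)
  interpret N: normal E ?K
    using sub by (intro K.normalI) (auto simp: r_coset_def l_coset_def, (metis comm)+)
  have "r_coset ?K E x = E" if "x \<in> E" for x
    using K.coset_join2[of x E] that sub by simp
  then have "carrier (?K Mod E) = {E}"
    using K.one_closed by (auto simp: FactGroup_def RCOSETS_def)
  then show ?thesis
    using N.factorgroup_is_group by (simp add: trivial_group_def A_FactGroup_def FactGroup_def)
qed

section \<open>Modules over the group ring of a cyclic group\<close>

text \<open>A generator has order \<open>|G|\<close>, so its powers with exponents below
  \<open>|G|\<close> are distinct and, by counting, exhaust the group.\<close>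

lemma cyclic_group_generator:
  assumes "group G" "cyclic_group G" "finite (carrier G)"
  obtains g where "g \<in> carrier G" "bij_betw (\<lambda>i. g [^]\<^bsub>G\<^esub> (i::nat)) {..<Coset.order G} (carrier G)"
proof -
  interpret group G by fact
  obtain g where g: "g \<in> carrier G" and gen: "carrier G = range (\<lambda>n::int. g [^]\<^bsub>G\<^esub> n)"
    using assms(2) by (auto simp: cyclic_group)
  have "generate G {g} = carrier G" using g gen by (auto simp: generate_pow)
  then have ord: "ord g = Coset.order G" using generate_pow_card[OF g] by (simp add: Coset.order_def)
  moreover have "Coset.order G > 0" using assms(3) by (simp add: order_gt_0_iff_finite)
  ultimately have "inj_on (\<lambda>i. g [^]\<^bsub>G\<^esub> i) {..<Coset.order G}"
    using ord_inj[OF g] by (auto intro: inj_on_subset)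
  moreover from this have "(\<lambda>i. g [^]\<^bsub>G\<^esub> i) ` {..<Coset.order G} = carrier G"
    using g assms(3) by (intro card_subset_eq) (auto simp: card_image Coset.order_def)
  ultimately show ?thesis using that g by (simp add: bij_betw_def)
qed

locale cyclic_group_ring_module =
  fixes R :: "('r, 'a) ring_scheme" and G :: "('g, 'b) monoid_scheme" and h :: "complex \<Rightarrow> 'r"
    and M :: "('g \<Rightarrow> 'r, 'm, 'c) module_scheme" and q :: nat and \<zeta> :: complex and g :: 'g
  assumes cring: "cring R" and group: "group G" and finite_G: "finite (carrier G)"
    and order_G: "Coset.order G = q"
    and g: "g \<in> carrier G" and gen: "bij_betw (\<lambda>i. g [^]\<^bsub>G\<^esub> (i::nat)) {..<q} (carrier G)"
    and prim: "primitive_root_of_unity q \<zeta>" and h: "h \<in> ring_hom (cyclotomic_integers \<zeta>) R"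
    and module: "module (group_ring R G) M" and finite_carrier: "finite (carrier M)"
begin

interpretation K: cring R by (rule cring)
interpretation G: group G by (rule group)

abbreviation cyc :: "complex set" where "cyc \<equiv> carrier (cyclotomic_integers \<zeta>)"
abbreviation scal :: "complex \<Rightarrow> 'g \<Rightarrow> 'r" where "scal c \<equiv> gr_monom R G (h c) \<one>\<^bsub>G\<^esub>"
abbreviation gel :: "'g \<Rightarrow> 'r" where "gel \<equiv> gr_monom R G \<one>\<^bsub>R\<^esub> g"

lemma q_pos: "q > 0" and \<zeta>_pow: "\<zeta> ^ q = 1"
  using prim by (auto simp: primitive_root_of_unity_def)

lemma g_pow_q: "g [^]\<^bsub>G\<^esub> q = \<one>\<^bsub>G\<^esub>"
  using G.pow_order_eq_1[OF g] order_G by simp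

lemma element_is_power:
  assumes "s \<in> carrier G"
  obtains i where "i < q" "s = g [^]\<^bsub>G\<^esub> i"
  using assms gen by (auto simp: bij_betw_def)

lemma root_closed: "z ^ q = 1 \<Longrightarrow> z \<in> cyc"
  using root_group_subset_Units[OF prim] by (auto simp: root_group_def Units_def)

lemma h_closed: "c \<in> cyc \<Longrightarrow> h c \<in> carrier R"
  using h by (simp add: ring_hom_closed)

lemma \<zeta>_inj: "inj_on (\<lambda>k. \<zeta> ^ k) {..<q}"
proof (rule linorder_inj_onI)
  fix i j assume ij: "i < j" "i \<in> {..<q}" "j \<in> {..<q}"
  then have "\<zeta> ^ j = \<zeta> ^ i * \<zeta> ^ (j - i)" by (simp flip: power_add)
  moreover have "\<zeta> ^ (j - i) \<noteq> 1" using ij prim by (auto simp: primitive_root_of_unity_def)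
  moreover have "\<zeta> \<noteq> 0" using \<zeta>_pow q_pos by (auto simp: zero_power)
  ultimately show "\<zeta> ^ i \<noteq> \<zeta> ^ j" by auto
qed auto

text \<open>Here \<open>A = R[G]\<close>, \<open>Z\<close> is the ring generated by
  \<open>\<zeta>\<close>, \<open>\<iota>\<close> sends \<open>c\<close> to \<open>h(c)\<close> times
  the identity of \<open>R[G]\<close>, and \<open>\<gamma>\<close> is the generator
  \<open>g\<close>.\<close>

sublocale E: root_eval_module "group_ring R G" cyc scal gel M q \<zeta>
proof -
  \<comment> \<open>The locale \<open>module\<close> contains commutativity of its scalar ring,
    which supplies the \<open>cring\<close> structure of \<open>R[G]\<close>.\<close>
  interpret module "group_ring R G" M by (rule module)
  note gm = K.gr_monom_mult[OF group finite_G]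
  have ops: "\<one>\<^bsub>cyclotomic_integers \<zeta>\<^esub> = 1" "x \<oplus>\<^bsub>cyclotomic_integers \<zeta>\<^esub> y = x + y"
    "x \<otimes>\<^bsub>cyclotomic_integers \<zeta>\<^esub> y = x * y" for x y
    by (simp_all add: cyclotomic_integers_def ring_of_type_algebra_def)
  have "scal 1 = \<one>\<^bsub>group_ring R G\<^esub>"
    using ring_hom_one[OF h] by (simp add: K.gr_monom_one ops)
  moreover have "scal (x + y) = scal x \<oplus>\<^bsub>group_ring R G\<^esub> scal y" if "x \<in> cyc" "y \<in> cyc" for x y
    using ring_hom_add[OF h that] that by (simp add: K.gr_monom_add h_closed ops)
  moreover have "scal (x * y) = scal x \<otimes>\<^bsub>group_ring R G\<^esub> scal y" if "x \<in> cyc" "y \<in> cyc" for x y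
    using ring_hom_mult[OF h that] that by (simp add: gm h_closed ops)
  moreover have "gel [^]\<^bsub>group_ring R G\<^esub> q = \<one>\<^bsub>group_ring R G\<^esub>"
    by (simp add: K.gr_monom_pow[OF group finite_G g] g_pow_q K.gr_monom_one)
  moreover have "0 \<in> cyc" "1 \<in> cyc" "\<And>x y. x \<in> cyc \<Longrightarrow> y \<in> cyc \<Longrightarrow> x + y \<in> cyc"
    "\<And>x y. x \<in> cyc \<Longrightarrow> y \<in> cyc \<Longrightarrow> x * y \<in> cyc" "\<And>x. x \<in> cyc \<Longrightarrow> - x \<in> cyc"
  proof -
    let ?S = "generate_ring ring_of_type_algebra {\<zeta>}"
    have cyc: "cyc = ?S" by (simp add: cyclotomic_integers_def)
    show 1: "1 \<in> cyc" using generate_ring.one[of ring_of_type_algebra "{\<zeta>}"]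
      by (simp add: cyc) (simp add: ring_of_type_algebra_def)
    show uminus: "- x \<in> cyc" if "x \<in> cyc" for x
      using generate_ring.a_inv[of x ring_of_type_algebra "{\<zeta>}"] that by (simp add: cyc a_inv_type_algebra)
    show add: "x + y \<in> cyc" if "x \<in> cyc" "y \<in> cyc" for x y
      using generate_ring.eng_add[of x ring_of_type_algebra "{\<zeta>}" y] that
      by (simp add: cyc) (simp add: ring_of_type_algebra_def)
    show "x * y \<in> cyc" if "x \<in> cyc" "y \<in> cyc" for x y
      using generate_ring.eng_mult[of x ring_of_type_algebra "{\<zeta>}" y] that
      by (simp add: cyc) (simp add: ring_of_type_algebra_def)
    show "0 \<in> cyc" using add[OF 1 uminus[OF 1]] by simp
  qed
  ultimately show "root_eval_module (group_ring R G) cyc scal gel M q \<zeta>"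
    using root_closed[OF \<zeta>_pow] q_pos \<zeta>_pow \<zeta>_inj finite_carrier
    by unfold_locales (simp_all add: h_closed)
qed

text \<open>Stated for arbitrary \<open>a\<close> because it serves both \<open>g\<close> and
  \<open>g^N\<close>, a generator of the subgroup \<open>H\<close>.\<close>

lemma smult_pow_eigen:
  assumes "a \<in> carrier (group_ring R G)" "v \<in> cyc" "m \<in> carrier M" "a \<odot>\<^bsub>M\<^esub> m = scal v \<odot>\<^bsub>M\<^esub> m"
  shows "(a [^]\<^bsub>group_ring R G\<^esub> (i::nat)) \<odot>\<^bsub>M\<^esub> m = scal (v ^ i) \<odot>\<^bsub>M\<^esub> m"
proof (induction i)
  case 0
  then show ?case using assms by simp
next
  case (Suc i)
  have "(a [^]\<^bsub>group_ring R G\<^esub> Suc i) \<odot>\<^bsub>M\<^esub> m = (a [^]\<^bsub>group_ring R G\<^esub> i) \<odot>\<^bsub>M\<^esub> (scal v \<odot>\<^bsub>M\<^esub> m)"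
    using assms by (simp add: E.smult_assoc1)
  also have "\<dots> = scal v \<odot>\<^bsub>M\<^esub> ((a [^]\<^bsub>group_ring R G\<^esub> i) \<odot>\<^bsub>M\<^esub> m)"
    using assms by (simp flip: E.smult_assoc1 add: E.m_comm[of _ "scal v"])
  also have "\<dots> = scal (v ^ Suc i) \<odot>\<^bsub>M\<^esub> m"
    using assms by (simp only: Suc) (simp add: E.\<iota>_mult E.Z_power E.smult_assoc1)
  finally show ?case .
qed

section \<open>Characters, eigenspaces and images in terms of the generator\<close>

lemma character_props:
  assumes "\<psi> \<in> characters q G"
  shows "\<psi> g \<in> cyc" "\<psi> g ^ q = 1" "\<psi> (g [^]\<^bsub>G\<^esub> (i::nat)) = \<psi> g ^ i"
proof -
  have hom: "\<psi> \<in> hom G (root_group q)" using assms by (simp add: characters_def)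
  show "\<psi> (g [^]\<^bsub>G\<^esub> i) = \<psi> g ^ i" by (rule character_power[OF group q_pos hom g])
  show "\<psi> g ^ q = 1" using hom_in_carrier[OF hom g] by (simp add: root_group_def)
  then show "\<psi> g \<in> cyc" by (rule root_closed)
qed

lemma eigenspace_eq_eigvecs:
  assumes "\<psi> \<in> characters q G"
  shows "eigenspace R G h \<psi> M = E.eigvecs (\<psi> g)"
proof (intro equalityI subsetI)
  fix m assume "m \<in> eigenspace R G h \<psi> M"
  then show "m \<in> E.eigvecs (\<psi> g)" using g by (auto simp: eigenspace_def E.eigvecs_def)
next
  fix m assume "m \<in> E.eigvecs (\<psi> g)"
  then have m: "m \<in> carrier M" "gel \<odot>\<^bsub>M\<^esub> m = scal (\<psi> g) \<odot>\<^bsub>M\<^esub> m" by (auto simp: E.eigvecs_def)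
  have "gr_monom R G \<one>\<^bsub>R\<^esub> s \<odot>\<^bsub>M\<^esub> m = scal (\<psi> s) \<odot>\<^bsub>M\<^esub> m" if "s \<in> carrier G" for s
  proof -
    from that obtain i where "i < q" and i: "s = g [^]\<^bsub>G\<^esub> i" by (rule element_is_power)
    show ?thesis
      using smult_pow_eigen[of gel "\<psi> g" m i] m character_props[OF assms]
      by (simp add: i K.gr_monom_pow[OF group finite_G g])
  qed
  then show "m \<in> eigenspace R G h \<psi> M" using m by (simp add: eigenspace_def)
qed

text \<open>Injectivity makes each group element occur at most once, so the coefficients can be read
  off. All exponents below \<open>q\<close> give \<open>\<epsilon>\<^sub>\<psi>\<close>; the
  multiples of \<open>N\<close> give the character element of \<open>H\<close>, extended by zero to
  \<open>G\<close>.\<close>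

lemma ev_sum_monom:
  assumes inj: "inj_on (\<lambda>i. g [^]\<^bsub>G\<^esub> i) J" and J: "finite J"
    and u: "u \<in> cyc" "u ^ q = 1" and \<psi>: "\<And>i. i \<in> J \<Longrightarrow> \<psi> (g [^]\<^bsub>G\<^esub> i) = u ^ i"
  shows "E.ev (\<Sum>i\<in>J. Polynomial.monom (inverse u ^ i) i) =
    (\<lambda>\<sigma>\<in>carrier G. if \<sigma> \<in> (\<lambda>i. g [^]\<^bsub>G\<^esub> i) ` J then h (inverse (\<psi> \<sigma>)) else \<zero>\<^bsub>R\<^esub>)"
proof -
  let ?B = "(\<lambda>i. g [^]\<^bsub>G\<^esub> i) ` J"
  have am: "abelian_monoid (group_ring R G)"
    by (intro abelian_group.axioms(1) ring.is_abelian_group ring_group_ring cring group finite_G)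
  define v where "v = inverse u"
  have v: "v \<in> cyc" and v\<psi>: "\<And>i. i \<in> J \<Longrightarrow> inverse (\<psi> (g [^]\<^bsub>G\<^esub> i)) = v ^ i"
    using E.inverse_Z[OF u] by (simp_all add: v_def \<psi> power_inverse)
  have hv: "h (v ^ i) \<in> carrier R" for i using v by (simp add: h_closed E.Z_power)
  have mon: "E.ev (Polynomial.monom (v ^ i) i) = gr_monom R G (h (v ^ i)) (g [^]\<^bsub>G\<^esub> i)" for i
    using v g hv by (simp add: E.ev_monom E.Z_power K.gr_monom_pow[OF group finite_G g]
        K.gr_monom_mult[OF group finite_G])
  have "E.ev (\<Sum>i\<in>J. Polynomial.monom (v ^ i) i) =
      (\<Oplus>\<^bsub>group_ring R G\<^esub>i\<in>J. gr_monom R G (h (inverse (\<psi> (g [^]\<^bsub>G\<^esub> i)))) (g [^]\<^bsub>G\<^esub> i))"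
    using J v hv v\<psi> by (subst E.ev_sum)
      (auto simp: mon E.polys_monom E.Z_power intro!: abelian_monoid.finsum_cong'[OF am])
  also have "\<dots> = (\<Oplus>\<^bsub>group_ring R G\<^esub>s\<in>?B. gr_monom R G (h (inverse (\<psi> s))) s)"
    using inj hv v\<psi> by (subst abelian_monoid.finsum_reindex[OF am]) auto
  also have "\<dots> = (\<lambda>s\<in>carrier G. if s \<in> ?B then h (inverse (\<psi> s)) else \<zero>\<^bsub>R\<^esub>)"
    using hv v\<psi> g by (intro K.finsum_gr_monom[OF group finite_G]) auto
  finally show ?thesis by (simp only: v_def)
qed

lemma char_image_eq:
  assumes "\<psi> \<in> characters q G"
  shows "char_image R G h \<psi> M = (\<lambda>m. E.ev (E.geom_poly (\<psi> g) q) \<odot>\<^bsub>M\<^esub> m) ` carrier M"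
proof -
  have "E.ev (E.geom_poly (\<psi> g) q) = (\<lambda>\<sigma>\<in>carrier G. h (inverse (\<psi> \<sigma>)))"
    unfolding E.geom_poly_def using character_props[OF assms] gen
    by (subst ev_sum_monom[where \<psi> = \<psi>]) (auto simp: bij_betw_def intro!: restrict_ext)
  then show ?thesis
    using char_elem_coeff[OF cring group finite_G prim h assms] by (simp add: char_image_def)
qed

text \<open>A character is determined by its value at \<open>g\<close>, and each \<open>q\<close>-th
  root of unity \<open>z\<close> occurs, through the character sending \<open>g^i\<close> to
  \<open>z^i\<close>.\<close>

lemma bij_betw_characters:
  "bij_betw (\<lambda>\<psi>. \<psi> g) (characters q G) ((\<lambda>k. \<zeta> ^ k) ` {..<q})"
proof -
  have roots: "{z. z ^ q = 1} = (\<lambda>k. \<zeta> ^ k) ` {..<q}"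
  proof (rule card_subset_eq[symmetric])
    show "finite {z::complex. z ^ q = 1}" using q_pos by (intro finite_roots_unity) auto
    have "(\<zeta> ^ k) ^ q = 1" for k by (metis \<zeta>_pow mult.commute power_mult power_one)
    then show "(\<lambda>k. \<zeta> ^ k) ` {..<q} \<subseteq> {z. z ^ q = 1}" by auto
    show "card ((\<lambda>k. \<zeta> ^ k) ` {..<q}) = card {z::complex. z ^ q = 1}"
      using q_pos by (simp add: card_image[OF \<zeta>_inj] card_roots_unity_eq)
  qed
  have "inj_on (\<lambda>\<psi>. \<psi> g) (characters q G)"
  proof (rule inj_onI)
    fix \<psi> \<phi> assume *: "\<psi> \<in> characters q G" "\<phi> \<in> characters q G" "\<psi> g = \<phi> g"
    show "\<psi> = \<phi>"
    proof (rule extensionalityI[where A = "carrier G"])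
      fix s assume "s \<in> carrier G"
      then obtain i where "i < q" "s = g [^]\<^bsub>G\<^esub> i" by (rule element_is_power)
      then show "\<psi> s = \<phi> s" using * by (simp add: character_props)
    qed (use * in \<open>auto simp: characters_def\<close>)
  qed
  moreover have "z \<in> (\<lambda>\<psi>. \<psi> g) ` characters q G" if z: "z ^ q = 1" for z
  proof -
    define dlog where "dlog = inv_into {..<q} (\<lambda>i. g [^]\<^bsub>G\<^esub> i)"
    define \<psi> where "\<psi> = (\<lambda>s\<in>carrier G. z ^ dlog s)"
    have dlog: "g [^]\<^bsub>G\<^esub> dlog s = s" if "s \<in> carrier G" for s
      using gen that unfolding dlog_def bij_betw_def by (intro f_inv_into_f) auto
    \<comment> \<open>Well-definedness: powers of \<open>g\<close> and of \<open>z\<close> depend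
      only on the exponent modulo \<open>q\<close>, and those of \<open>g\<close> determine it. This
      is needed since \<open>dlog (s t)\<close> and \<open>dlog s + dlog t\<close> may differ by
      \<open>q\<close>.\<close>
    have z_cong: "z ^ i = z ^ j" if "g [^]\<^bsub>G\<^esub> i = g [^]\<^bsub>G\<^esub> j" for i j :: nat
    proof -
      have mod: "g [^]\<^bsub>G\<^esub> (i mod q) = g [^]\<^bsub>G\<^esub> i" "z ^ (i mod q) = z ^ i" for i
      proof -
        have "g [^]\<^bsub>G\<^esub> i = (g [^]\<^bsub>G\<^esub> q) [^]\<^bsub>G\<^esub> (i div q) \<otimes>\<^bsub>G\<^esub> g [^]\<^bsub>G\<^esub> (i mod q)"
          using g by (simp add: G.nat_pow_pow G.nat_pow_mult)
        then show "g [^]\<^bsub>G\<^esub> (i mod q) = g [^]\<^bsub>G\<^esub> i" using g by (simp add: g_pow_q)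
        have "z ^ i = (z ^ q) ^ (i div q) * z ^ (i mod q)" by (simp flip: power_mult power_add)
        then show "z ^ (i mod q) = z ^ i" using z by simp
      qed
      have "g [^]\<^bsub>G\<^esub> (i mod q) = g [^]\<^bsub>G\<^esub> (j mod q)" using that by (simp add: mod)
      then have "i mod q = j mod q"
        using gen q_pos by (auto simp: bij_betw_def dest: inj_onD)
      then show ?thesis using mod(2)[of i] mod(2)[of j] by simp
    qed
    have "(z ^ k) ^ q = 1" for k by (metis z mult.commute power_mult power_one)
    moreover have "\<psi> (s \<otimes>\<^bsub>G\<^esub> t) = \<psi> s * \<psi> t" if "s \<in> carrier G" "t \<in> carrier G" for s t
    proof -
      have "g [^]\<^bsub>G\<^esub> dlog (s \<otimes>\<^bsub>G\<^esub> t) = g [^]\<^bsub>G\<^esub> (dlog s + dlog t)"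
        using that g dlog by (simp flip: G.nat_pow_mult)
      then have "z ^ dlog (s \<otimes>\<^bsub>G\<^esub> t) = z ^ (dlog s + dlog t)" by (rule z_cong)
      then show ?thesis using that by (simp add: \<psi>_def power_add)
    qed
    ultimately have "\<psi> \<in> characters q G"
      by (auto simp: characters_def hom_def root_group_def \<psi>_def)
    moreover have "\<psi> g = z"
      using z_cong[of "dlog g" 1] dlog[OF g] g by (simp add: \<psi>_def)
    ultimately show ?thesis by blast
  qed
  ultimately show ?thesis
    using character_props by (auto simp: bij_betw_def simp flip: roots)
qed

text \<open>The inclusion of \<open>\<epsilon>\<^sub>\<psi> M\<close> in
  \<open>M\<^sup>\<psi>\<close>: the product of \<open>X - u\<close> and the geometric sum is
  \<open>u (X^q - 1)\<close>, which vanishes at \<open>g\<close>.\<close>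

lemma geom_image_subset_eigvecs:
  assumes u: "u \<in> cyc" "u ^ q = 1"
  shows "(\<lambda>m. E.ev (E.geom_poly u q) \<odot>\<^bsub>M\<^esub> m) ` carrier M \<subseteq> E.eigvecs u"
proof -
  note u' = E.inverse_Z[OF u]
  have polys: "[:- u, 1:] \<in> E.polys" "E.geom_poly u q \<in> E.polys"
    using u u' by (auto simp: E.geom_poly_def intro!: E.linear_polys E.polys_intros)
  have "[:- u, 1:] * E.geom_poly u q = Polynomial.smult u (Polynomial.monom 1 q - 1)"
    using linear_mult_geometric_sum[OF u'(1), of q] u(2) by (simp only: E.geom_poly_def power_inverse inverse_1)
  then have "E.ev [:- u, 1:] \<otimes>\<^bsub>group_ring R G\<^esub> E.ev (E.geom_poly u q) =
      E.ev (Polynomial.smult u (Polynomial.monom 1 q - 1))"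
    using polys by (simp only: flip: E.ev_mult)
  also have "\<dots> = \<zero>\<^bsub>group_ring R G\<^esub>"
    using u E.polys_add[of "Polynomial.monom 1 q" "- 1"]
    by (simp add: E.ev_smult E.polys_intros E.ev_monom_diff_1[OF E.\<gamma>_pow])
  finally show ?thesis
    using polys u by (auto simp: E.eigvecs_iff simp flip: E.smult_assoc1)
qed

lemma subgroup_eigvecs:
  assumes "u \<in> cyc"
  shows "subgroup (E.eigvecs u) (add_monoid M)"
  using assms
  by (intro E.M.add.subgroupI)
    (auto simp: E.eigvecs_def E.smult_r_distr E.smult_r_minus simp flip: a_inv_def)

text \<open>The assumed inclusion makes \<open>M\<^sup>\<psi>\<close> and
  \<open>\<epsilon>\<^sub>\<psi> M\<close> equal, so the quotients are trivial and both products
  agree. The product over exponents \<open>k\<close> becomes one over characters by matching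
  \<open>\<zeta>^k\<close> with \<open>\<psi>(g)\<close>.\<close>

theorem H0_trivial_and_card:
  assumes "\<And>\<psi>. \<psi> \<in> characters q G \<Longrightarrow>
    E.eigvecs (\<psi> g) \<subseteq> (\<lambda>m. E.ev (E.geom_poly (\<psi> g) q) \<odot>\<^bsub>M\<^esub> m) ` carrier M"
  shows "(\<forall>\<psi>\<in>characters q G. trivial_group (char_H0 R G h \<psi> M)) \<and>
    card (carrier M) = (\<Prod>\<psi>\<in>characters q G. card (eigenspace R G h \<psi> M)) \<and>
    card (carrier M) = (\<Prod>\<psi>\<in>characters q G. card (char_image R G h \<psi> M))"
proof -
  have eq: "eigenspace R G h \<psi> M = E.eigvecs (\<psi> g)" "char_image R G h \<psi> M = E.eigvecs (\<psi> g)"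
    if \<psi>: "\<psi> \<in> characters q G" for \<psi>
    using eigenspace_eq_eigvecs[OF \<psi>] char_image_eq[OF \<psi>] assms[OF \<psi>]
      geom_image_subset_eigvecs[OF character_props(1,2)[OF \<psi>]] by auto
  have sub: "E.eigvecs (\<zeta> ^ k) \<subseteq> (\<lambda>m. E.ev (E.geom_poly (\<zeta> ^ k) q) \<odot>\<^bsub>M\<^esub> m) ` carrier M" if "k < q" for k
  proof -
    have "\<zeta> ^ k \<in> (\<lambda>\<psi>. \<psi> g) ` characters q G"
      using bij_betw_characters that by (auto simp: bij_betw_def)
    then obtain \<psi> where "\<psi> \<in> characters q G" "\<zeta> ^ k = \<psi> g" by blast
    then show ?thesis using assms[of \<psi>] by simp
  qed
  have "card (carrier M) = (\<Prod>k<q. card (E.eigvecs (\<zeta> ^ k)))"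
    by (rule E.card_eq_prod_eigvecs[OF sub])
  also have "\<dots> = (\<Prod>z\<in>(\<lambda>k. \<zeta> ^ k) ` {..<q}. card (E.eigvecs z))"
    by (simp add: prod.reindex[OF \<zeta>_inj])
  also have "\<dots> = (\<Prod>\<psi>\<in>characters q G. card (E.eigvecs (\<psi> g)))"
    by (rule prod.reindex_bij_betw[OF bij_betw_characters, symmetric])
  finally have "card (carrier M) = (\<Prod>\<psi>\<in>characters q G. card (E.eigvecs (\<psi> g)))" .
  moreover have "trivial_group (char_H0 R G h \<psi> M)" if \<psi>: "\<psi> \<in> characters q G" for \<psi>
    unfolding char_H0_def eq[OF \<psi>]
    by (intro E.M.A_Mod_self_trivial subgroup_eigvecs character_props[OF \<psi>])
  ultimately show ?thesis by (simp add: eq)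
qed

section \<open>From the subgroup \<open>H\<close> to the whole group\<close>

text \<open>If \<open>g^j\<close> lies in \<open>H\<close>, then \<open>g^(j p) = 1\<close>, so
  \<open>N p\<close> divides \<open>j p\<close> and \<open>N\<close> divides \<open>j\<close>;
  counting gives equality. The injectivity has the form that \<open>ev_sum_monom\<close>
  requires.\<close>

lemma subgroup_eq_powers:
  assumes qNp: "q = N * p" and H: "subgroup H G" "card H = p"
  shows "H = (\<lambda>i. g [^]\<^bsub>G\<^esub> (N * i)) ` {..<p}" and "inj_on (\<lambda>i. g [^]\<^bsub>G\<^esub> i) ((\<lambda>i. N * i) ` {..<p})"
proof -
  have N: "N > 0" "p > 0" using q_pos qNp by auto
  have lt: "N * i < q" if "i < p" for i using that N by (simp add: qNp)
  have inj: "inj_on (\<lambda>i. g [^]\<^bsub>G\<^esub> i) {..<q}" using gen by (simp add: bij_betw_def)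
  then show 1: "inj_on (\<lambda>i. g [^]\<^bsub>G\<^esub> i) ((\<lambda>i. N * i) ` {..<p})"
    by (rule inj_on_subset) (auto simp: lt)
  have "inj_on (\<lambda>i. N * i) {..<p}" using N by (auto simp: inj_on_def)
  from comp_inj_on[OF this 1] have "card ((\<lambda>i. g [^]\<^bsub>G\<^esub> (N * i)) ` {..<p}) = p"
    by (simp add: card_image o_def)
  moreover have "H \<subseteq> (\<lambda>i. g [^]\<^bsub>G\<^esub> (N * i)) ` {..<p}"
  proof
    fix s assume s: "s \<in> H"
    then have "s \<in> carrier G" using subgroup.subset[OF H(1)] by auto
    then obtain j where j: "j < q" "s = g [^]\<^bsub>G\<^esub> j" by (rule element_is_power)
    interpret H: group "G\<lparr>carrier := H\<rparr>" by (rule G.subgroup_imp_group[OF H(1)])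
    have "s [^]\<^bsub>G\<lparr>carrier := H\<rparr>\<^esub> p = \<one>\<^bsub>G\<^esub>"
      using H.pow_order_eq_1[of s] s H(2) by (simp add: Coset.order_def)
    then have "g [^]\<^bsub>G\<^esub> (j * p) = \<one>\<^bsub>G\<^esub>"
      using j g by (simp add: G.nat_pow_consistent G.nat_pow_pow flip: G.nat_pow_consistent)
    moreover have "G.ord g = q"
    proof -
      have "carrier G = generate G {g}"
        using gen g G.generate_pow_on_finite_carrier[OF finite_G g] by (auto simp: bij_betw_def)
      then show ?thesis using G.generate_pow_card[OF g] order_G by (simp add: Coset.order_def)
    qed
    ultimately have "N * p dvd j * p" using G.pow_eq_id[OF g] qNp by simp
    then have "N dvd j" using N by simp
    then obtain i where i: "j = N * i" by (elim dvdE)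
    then have "i < p" using j qNp N by simp
    with i j show "s \<in> (\<lambda>i. g [^]\<^bsub>G\<^esub> (N * i)) ` {..<p}" by auto
  qed
  ultimately show "H = (\<lambda>i. g [^]\<^bsub>G\<^esub> (N * i)) ` {..<p}"
    using H(2) by (intro card_subset_eq) auto
qed

text \<open>Turns the vanishing condition over \<open>R[H]\<close> into the assumption
  \<open>hyp\<close> of \<open>eigvecs_subset_image\<close>, where everything acts through
  \<open>R[G]\<close>.\<close>

lemma H0_subgroup_trivialD:
  assumes qNp: "q = N * p" and H: "subgroup H G" "card H = p" and \<psi>: "\<psi> \<in> characters q G"
    and triv: "\<And>\<chi>. \<chi> \<in> characters q (G\<lparr>carrier := H\<rparr>) \<Longrightarrow>
      trivial_group (char_H0 R (G\<lparr>carrier := H\<rparr>) h \<chi> (restrict_module R G H M))"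
    and m: "m \<in> carrier M" "gel [^]\<^bsub>group_ring R G\<^esub> N \<odot>\<^bsub>M\<^esub> m = scal (\<psi> g ^ N) \<odot>\<^bsub>M\<^esub> m"
  shows "m \<in> (\<lambda>m. E.ev (\<Sum>i<p. Polynomial.monom (inverse (\<psi> g) ^ (N * i)) (N * i)) \<odot>\<^bsub>M\<^esub> m) ` carrier M"
proof -
  let ?H = "G\<lparr>carrier := H\<rparr>" and ?M = "restrict_module R G H M"
  let ?T = "E.ev (\<Sum>i<p. Polynomial.monom (inverse (\<psi> g) ^ (N * i)) (N * i))"
  note Heq = subgroup_eq_powers[OF qNp H]
  have N: "N > 0" using q_pos qNp by auto
  have HG: "H \<subseteq> carrier G" using H(1) by (rule subgroup.subset)
  have gH: "group ?H" by (rule G.subgroup_imp_group[OF H(1)])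
  have fH: "finite (carrier ?H)" using HG finite_G by (auto intro: finite_subset)
  \<comment> \<open>Cutting \<open>\<psi>\<close> off outside \<open>H\<close> makes it extensional,
    as \<open>characters\<close> demands.\<close>
  define \<chi> where "\<chi> = restrict \<psi> H"
  have \<chi>: "\<chi> \<in> characters q ?H"
    using \<psi> HG subgroup.m_closed[OF H(1)] by (auto simp: characters_def \<chi>_def hom_def subset_iff Pi_iff)
  have \<chi>_eq: "\<chi> s = \<psi> s" if "s \<in> H" for s using that by (simp add: \<chi>_def)
  have "?T = (\<lambda>\<sigma>\<in>carrier G. if \<sigma> \<in> (\<lambda>i. g [^]\<^bsub>G\<^esub> i) ` ((\<lambda>i. N * i) ` {..<p}) then h (inverse (\<psi> \<sigma>)) else \<zero>\<^bsub>R\<^esub>)"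
    using ev_sum_monom[OF Heq(2), of "\<psi> g" \<psi>] character_props[OF \<psi>] N
    by (simp add: sum.reindex inj_on_def)
  also have "(\<lambda>i. g [^]\<^bsub>G\<^esub> i) ` ((\<lambda>i. N * i) ` {..<p}) = H"
    by (simp add: Heq(1) image_image)
  \<comment> \<open>The element \<open>\<epsilon>\<^sub>\<chi>\<close> of \<open>R[H]\<close>,
    viewed in \<open>R[G]\<close>, is the polynomial value \<open>t\<close>.\<close>
  finally have T: "gr_incl R G H (char_elem R ?H h \<chi>) = ?T"
    using char_elem_coeff[OF cring gH fH prim h \<chi>] HG
    by (auto simp: gr_incl_def \<chi>_eq intro!: restrict_ext)
  have image: "char_image R ?H h \<chi> ?M = (\<lambda>m. ?T \<odot>\<^bsub>M\<^esub> m) ` carrier M"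
    by (simp add: char_image_def restrict_module_def T)
  \<comment> \<open>Each element of \<open>H\<close> is \<open>(g^N)^i\<close>, so the eigenvalue
    equation at \<open>g^N\<close> gives it on all of \<open>H\<close>.\<close>
  have "m \<in> eigenspace R ?H h \<chi> ?M"
  proof -
    have "gr_monom R G \<one>\<^bsub>R\<^esub> s \<odot>\<^bsub>M\<^esub> m = scal (\<psi> s) \<odot>\<^bsub>M\<^esub> m" if s: "s \<in> H" for s
    proof -
      obtain i where i: "s = g [^]\<^bsub>G\<^esub> (N * i)" using s Heq(1) by auto
      show ?thesis
        using smult_pow_eigen[of "gel [^]\<^bsub>group_ring R G\<^esub> N" "\<psi> g ^ N" m i] m character_props[OF \<psi>] g
        by (simp add: i K.gr_monom_pow[OF group finite_G] G.nat_pow_pow E.Z_power power_mult)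
    qed
    then show ?thesis
      using m HG subgroup.one_closed[OF H(1)]
      by (simp add: eigenspace_def restrict_module_def gr_incl_monom \<chi>_eq)
  qed
  moreover have "abelian_group ?M"
    using E.M.abelian_group_axioms
    by (auto simp: restrict_module_def abelian_group_def abelian_monoid_def abelian_group_axioms_def)
  then have "eigenspace R ?H h \<chi> ?M \<subseteq> char_image R ?H h \<chi> ?M"
  proof (rule abelian_group.A_Mod_trivialD)
    show "trivial_group (?M\<lparr>carrier := eigenspace R ?H h \<chi> ?M\<rparr> A_Mod char_image R ?H h \<chi> ?M)"
      using triv[OF \<chi>] by (simp add: char_H0_def)
    show "eigenspace R ?H h \<chi> ?M \<subseteq> carrier ?M" by (auto simp: eigenspace_def)
    have "?T \<in> carrier (group_ring R G)"
      using E.inverse_Z[OF character_props(1,2)[OF \<psi>]] by (intro E.ev_closed E.polys_intros) auto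
    then show "\<zero>\<^bsub>?M\<^esub> \<in> char_image R ?H h \<chi> ?M"
      unfolding image by (intro image_eqI[of _ _ "\<zero>\<^bsub>M\<^esub>"]) (simp_all add: restrict_module_def)
  qed
  ultimately show ?thesis using image by auto
qed

end

theorem theorem4p10:
  fixes p n :: nat
    and \<zeta> :: complex
    and R :: "('r, 'a) ring_scheme"
    and h :: "complex \<Rightarrow> 'r"
    and G :: "('g, 'b) monoid_scheme"
    and H :: "'g set"
    and M :: "('g \<Rightarrow> 'r, 'm, 'c) module_scheme"
  assumes "Factorial_Ring.prime p" and "n \<ge> 1"
    and "group G" and "cyclic_group G" and "Coset.order G = p ^ n"
    and "subgroup H G" and "card H = p"
    and "primitive_root_of_unity (p ^ n) \<zeta>"
    and "cring R" and "h \<in> ring_hom (cyclotomic_integers \<zeta>) R"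
    and "module (group_ring R G) M" and "finite (carrier M)"
    and "\<forall>\<chi>\<in>characters (p ^ n) (G\<lparr>carrier := H\<rparr>).
           trivial_group (char_H0 R (G\<lparr>carrier := H\<rparr>) h \<chi> (restrict_module R G H M))"
  shows "(\<forall>\<psi>\<in>characters (p ^ n) G. trivial_group (char_H0 R G h \<psi> M)) \<and>
         card (carrier M) = (\<Prod>\<psi>\<in>characters (p ^ n) G. card (eigenspace R G h \<psi> M)) \<and>
         card (carrier M) = (\<Prod>\<psi>\<in>characters (p ^ n) G. card (char_image R G h \<psi> M))"
proof -
  \<comment> \<open>Fixes \<open>N = p^(n-1)\<close>, so that \<open>r = n - 1\<close> below;
    \<open>n \<ge> 1\<close> makes the truncated subtraction exact.\<close>
  have q: "p ^ n = p ^ (n - 1) * p" using assms(2) by (simp flip: power_Suc2)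
  have "p ^ n > 0" using assms(1) by (simp add: prime_gt_0_nat)
  \<comment> \<open>The order is a \<open>card\<close>, which is 0 on infinite sets, so a positive
    order forces finiteness.\<close>
  then have fin: "finite (carrier G)"
    using assms(5) by (metis card.infinite less_irrefl Coset.order_def)
  obtain g where "g \<in> carrier G" "bij_betw (\<lambda>i. g [^]\<^bsub>G\<^esub> (i::nat)) {..<Coset.order G} (carrier G)"
    using cyclic_group_generator[OF assms(3,4) fin] .
  then interpret cyclic_group_ring_module R G h M "p ^ n" \<zeta> g
    using assms(3,5,8-12) fin by (intro cyclic_group_ring_module.intro) auto
  show ?thesis
  proof (rule H0_trivial_and_card)
    fix \<psi> assume \<psi>: "\<psi> \<in> characters (p ^ n) G"
    show "E.eigvecs (\<psi> g) \<subseteq> (\<lambda>m. E.ev (E.geom_poly (\<psi> g) (p ^ n)) \<odot>\<^bsub>M\<^esub> m) ` carrier M"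
    proof (rule E.eigvecs_subset_image[OF q])
      fix m assume "m \<in> carrier M" "gel [^]\<^bsub>group_ring R G\<^esub> (p ^ (n - 1)) \<odot>\<^bsub>M\<^esub> m = scal (\<psi> g ^ p ^ (n - 1)) \<odot>\<^bsub>M\<^esub> m"
      then show "m \<in> (\<lambda>m. E.ev (\<Sum>i<p. Polynomial.monom (inverse (\<psi> g) ^ (p ^ (n - 1) * i)) (p ^ (n - 1) * i)) \<odot>\<^bsub>M\<^esub> m) ` carrier M"
        using H0_subgroup_trivialD[OF q assms(6,7) \<psi>] assms(13) by blast
    qed (use character_props[OF \<psi>] in auto)
  qed
qed

end
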